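(* Let $T$ be a complete first-order theory, $\mathfrak{C}$ a monster model of $T$ and $\bar c$ an enumeration of $\mathfrak{C}$. (i) A complete type $q\in S_{\bar x}(\emptyset)$ in finitely many variables has the externally definable elementary embedding Ramsey property (EDEERP) if and only if there exists $\eta\in\mathrm{EL}(S_{\bar c}(\mathfrak{C}))$ such that $\mathrm{Im}(\eta)\subseteq \mathrm{Inv}_{q,\bar c}(\mathfrak{C})$. (ii) $T$ has EDEERP if and only if there exists $\eta\in\mathrm{EL}(S_{\bar c}(\mathfrak{C}))$ such that $\mathrm{Im}(\eta)\subseteq \mathrm{Inv}_{\bar c}(\mathfrak{C})$.
   Context: A monster model is a $\kappa$-saturated, strongly $\kappa$-homogeneous model for a large cardinal $\kappa$. $S_{\bar c}(\mathfrak{C})$ is the space of complete types over $\mathfrak{C}$ extending $\mathrm{tp}(\bar c/\emptyset)$, an $\mathrm{Aut}(\mathfrak{C})$-flow under the natural action. For a topological group $G$ acting continuously on a compact Hausdorff space $X$, the Ellis semigroup $\mathrm{EL}(X)$ is the closure in $X^X$ (product topology) of the set of maps $x\mapsto gx$, $g\in G$, with composition as operation. $\mathrm{Inv}_{\bar c}(\mathfrak{C})$ is the set of $\mathrm{Aut}(\mathfrak{C})$-invariant types in $S_{\bar c}(\mathfrak{C})$. For a finitary type $q\in S_{\bar x}(\emptyset)$, $\mathrm{Inv}_{q,\bar c}(\mathfrak{C})$ is the set of $p(\bar y)\in S_{\bar c}(\mathfrak{C})$ ($\bar y$ the variables of $\bar c$) such that for every formula $\varphi(\bar x,\bar y)$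 without parameters and all $\bar a,\bar a'\models q$: $\varphi(\bar a,\bar y)\in p$ iff $\varphi(\bar a',\bar y)\in p$. For a finite tuple $\bar a$ and a set (or tuple, viewed as the set of its coordinates) $C\subseteq\mathfrak{C}$, $\binom{C}{\bar a}$ is the set of tuples $\bar a'$ of elements of $C$ with $\bar a'\equiv\bar a$ (same type over $\emptyset$). A coloring $c:\binom{\mathfrak{C}}{\bar a}\to 2^n$ is externally definable if there are formulae without parameters $\varphi_i(\bar x,\bar y)$ and types $p_i(\bar y)\in S_{\bar y}(\mathfrak{C})$, $i<n$, such that $c(\bar a')(i)=1$ iff $\varphi_i(\bar a',\bar y)\in p_i$. A set $S$ is monochromatic for $c$ if $c[S]$ is a singleton. A finitary type $q\in S(\emptyset)$ has EDEERP if for some (equivalently any) $\bar a\models q$, every finite tuple $\bar b\subseteq\mathfrak{C}$ containing $\bar a$, every $n<\omega$ and every externally definable coloring $c:\binom{\mathfrak{C}}{\bar a}\to 2^n$, there is $\bar b'\in\binom{\mathfrak{C}}{\bar b}$ such that $\binom{\bar b'}{\bar a}$ is monochromatic for $c$. $T$ has EDEERP if every finitary type in $S(\emptyset)$ has it (equivalently, the same condition holds for all finite $\bar a\subseteq\bar b\subseteq\mathfrak{C}$). *)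

theory Defs
  imports "HOL-Analysis.Function_Topology"
begin

unbundle cardinal_syntax

text \<open>
  First-order logic with equality. Bound variables are de Bruijn indices; free variables and
  parameters (names for elements of the structure) are separate constructors. Symbols are taken
  from sets, so that languages without function or relation symbols are included.
\<close>

record ('f, 'r) lang =
  funs :: "'f set"
  rels :: "'r set"
  fun_ar :: "'f \<Rightarrow> nat"
  rel_ar :: "'r \<Rightarrow> nat"

datatype (dead 'f, fvars_tm: 'v, params_tm: 'm) tm =
    BVar nat
  | FVar 'v
  | Param 'm
  | Fun 'f "('f, 'v, 'm) tm list"
  for map: map_tm

datatype (dead 'f, dead 'r, fvars: 'v, params: 'm) fm =
    Eq "('f, 'v, 'm) tm" "('f, 'v, 'm) tm"
  | Rel 'r "('f, 'v, 'm) tm list"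
  | Neg "('f, 'r, 'v, 'm) fm"
  | Conj "('f, 'r, 'v, 'm) fm" "('f, 'r, 'v, 'm) fm"
  | Exist "('f, 'r, 'v, 'm) fm"
  for map: map_fm

text \<open>The number \<open>k\<close> is the number of enclosing quantifiers.\<close>

primrec wf_tm :: "('f, 'r) lang \<Rightarrow> nat \<Rightarrow> ('f, 'v, 'm) tm \<Rightarrow> bool" where
  "wf_tm L k (BVar j) \<longleftrightarrow> j < k"
| "wf_tm L k (FVar x) \<longleftrightarrow> True"
| "wf_tm L k (Param m) \<longleftrightarrow> True"
| "wf_tm L k (Fun f ts) \<longleftrightarrow> f \<in> funs L \<and> length ts = fun_ar L f \<and> list_all (wf_tm L k) ts"

primrec wf_fm :: "('f, 'r) lang \<Rightarrow> nat \<Rightarrow> ('f, 'r, 'v, 'm) fm \<Rightarrow> bool" where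
  "wf_fm L k (Eq s t) \<longleftrightarrow> wf_tm L k s \<and> wf_tm L k t"
| "wf_fm L k (Rel r ts) \<longleftrightarrow> r \<in> rels L \<and> length ts = rel_ar L r \<and> list_all (wf_tm L k) ts"
| "wf_fm L k (Neg \<phi>) \<longleftrightarrow> wf_fm L k \<phi>"
| "wf_fm L k (Conj \<phi> \<psi>) \<longleftrightarrow> wf_fm L k \<phi> \<and> wf_fm L k \<psi>"
| "wf_fm L k (Exist \<phi>) \<longleftrightarrow> wf_fm L (Suc k) \<phi>"

text \<open>\<open>L\<close>-formulas with free variables from \<open>X\<close> and parameters from \<open>A\<close>.\<close>

definition Fml :: "('f, 'r) lang \<Rightarrow> 'v set \<Rightarrow> 'm set \<Rightarrow> ('f, 'r, 'v, 'm) fm set" where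
  "Fml L X A = {\<phi>. wf_fm L 0 \<phi> \<and> fvars \<phi> \<subseteq> X \<and> params \<phi> \<subseteq> A}"

text \<open>The universe of a structure is the whole type \<open>'m\<close>.\<close>

record ('f, 'r, 'm) struct =
  fun_int :: "'f \<Rightarrow> 'm list \<Rightarrow> 'm"
  rel_int :: "'r \<Rightarrow> 'm list \<Rightarrow> bool"

primrec eval :: "('f, 'r, 'm) struct \<Rightarrow> (nat \<Rightarrow> 'm) \<Rightarrow> ('v \<Rightarrow> 'm) \<Rightarrow> ('f, 'v, 'm) tm \<Rightarrow> 'm" where
  "eval M e v (BVar j) = e j"
| "eval M e v (FVar x) = v x"
| "eval M e v (Param m) = m"
| "eval M e v (Fun f ts) = fun_int M f (map (eval M e v) ts)"

primrec sat_env ::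
  "('f, 'r, 'm) struct \<Rightarrow> (nat \<Rightarrow> 'm) \<Rightarrow> ('v \<Rightarrow> 'm) \<Rightarrow> ('f, 'r, 'v, 'm) fm \<Rightarrow> bool" where
  "sat_env M e v (Eq s t) \<longleftrightarrow> eval M e v s = eval M e v t"
| "sat_env M e v (Rel r ts) \<longleftrightarrow> rel_int M r (map (eval M e v) ts)"
| "sat_env M e v (Neg \<phi>) \<longleftrightarrow> \<not> sat_env M e v \<phi>"
| "sat_env M e v (Conj \<phi> \<psi>) \<longleftrightarrow> sat_env M e v \<phi> \<and> sat_env M e v \<psi>"
| "sat_env M e v (Exist \<phi>) \<longleftrightarrow> (\<exists>x. sat_env M (case_nat x e) v \<phi>)"

text \<open>The environment for bound variables is irrelevant for formulas in \<^const>\<open>Fml\<close>.\<close>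

definition sat :: "('f, 'r, 'm) struct \<Rightarrow> ('v \<Rightarrow> 'm) \<Rightarrow> ('f, 'r, 'v, 'm) fm \<Rightarrow> bool" where
  "sat M v \<phi> \<longleftrightarrow> sat_env M (\<lambda>_. undefined) v \<phi>"

text \<open>
  A complete theory is a maximal consistent set of sentences; consistency is not part of the
  definition, since theories occur below only together with a model.
\<close>

definition complete_theory :: "('f, 'r) lang \<Rightarrow> ('f, 'r, nat, 'm) fm set \<Rightarrow> bool" where
  "complete_theory L T \<longleftrightarrow> T \<subseteq> Fml L {} {} \<and> (\<forall>\<phi>\<in>Fml L {} {}. \<phi> \<in> T \<or> Neg \<phi> \<in> T)"

definition is_model :: "('f, 'r, 'm) struct \<Rightarrow> ('f, 'r, nat, 'm) fm set \<Rightarrow> bool" where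
  "is_model M T \<longleftrightarrow> (\<forall>\<phi>\<in>T. \<forall>v. sat M v \<phi>)"

text \<open>
  Complete types over \<open>A\<close> in the variables \<open>X\<close>. Consistency of a set of formulas with the
  elementary diagram of the model is finite satisfiability in the model.
\<close>

definition ctypes ::
  "('f, 'r) lang \<Rightarrow> ('f, 'r, 'm) struct \<Rightarrow> 'v set \<Rightarrow> 'm set \<Rightarrow> ('f, 'r, 'v, 'm) fm set set" where
  "ctypes L M X A = {p. p \<subseteq> Fml L X A
     \<and> (\<forall>F. finite F \<and> F \<subseteq> p \<longrightarrow> (\<exists>v. \<forall>\<phi>\<in>F. sat M v \<phi>))
     \<and> (\<forall>\<phi>\<in>Fml L X A. \<phi> \<in> p \<or> Neg \<phi> \<in> p)}"

text \<open>Finite tuples are lists; the variables of an \<open>n\<close>-tuple are the numbers below \<open>n\<close>.\<close>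

definition realizes :: "('f, 'r, 'm) struct \<Rightarrow> nat \<Rightarrow> 'm list \<Rightarrow> ('f, 'r, nat, 'm) fm set \<Rightarrow> bool" where
  "realizes M n a q \<longleftrightarrow> length a = n \<and> (\<forall>\<phi>\<in>q. sat M (nth a) \<phi>)"

definition same_type :: "('f, 'r) lang \<Rightarrow> ('f, 'r, 'm) struct \<Rightarrow> 'm list \<Rightarrow> 'm list \<Rightarrow> bool" where
  "same_type L M a b \<longleftrightarrow> length a = length b
     \<and> (\<forall>\<phi>\<in>Fml L {..<length a} {}. sat M (nth a) \<phi> \<longleftrightarrow> sat M (nth b) \<phi>)"

definition Aut :: "('f, 'r) lang \<Rightarrow> ('f, 'r, 'm) struct \<Rightarrow> ('m \<Rightarrow> 'm) set" where
  "Aut L M = {g. bij g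
     \<and> (\<forall>f\<in>funs L. \<forall>xs. length xs = fun_ar L f \<longrightarrow> g (fun_int M f xs) = fun_int M f (map g xs))
     \<and> (\<forall>r\<in>rels L. \<forall>xs. length xs = rel_ar L r \<longrightarrow> rel_int M r (map g xs) = rel_int M r xs)}"

definition elementary_map ::
  "('f, 'r) lang \<Rightarrow> ('f, 'r, 'm) struct \<Rightarrow> 'm set \<Rightarrow> ('m \<Rightarrow> 'm) \<Rightarrow> bool" where
  "elementary_map L M A g \<longleftrightarrow> (\<forall>a. set a \<subseteq> A \<longrightarrow> same_type L M a (map g a))"

definition saturated :: "('f, 'r) lang \<Rightarrow> 'k rel \<Rightarrow> ('f, 'r, 'm) struct \<Rightarrow> bool" where
  "saturated L \<kappa> M \<longleftrightarrow>
     (\<forall>A n. |A| <o \<kappa> \<longrightarrow> (\<forall>p\<in>ctypes L M {..<n} A. \<exists>a. realizes M n a p))"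

definition strongly_homogeneous :: "('f, 'r) lang \<Rightarrow> 'k rel \<Rightarrow> ('f, 'r, 'm) struct \<Rightarrow> bool" where
  "strongly_homogeneous L \<kappa> M \<longleftrightarrow>
     (\<forall>A g. |A| <o \<kappa> \<and> elementary_map L M A g \<longrightarrow> (\<exists>\<sigma>\<in>Aut L M. \<forall>x\<in>A. \<sigma> x = g x))"

text \<open>
  Large means greater than \<open>|L| + \<aleph>\<^sub>0\<close>; every stronger reading of ``large'' is an instance.
\<close>

definition monster_model ::
  "('f, 'r) lang \<Rightarrow> ('f, 'r, nat, 'm) fm set \<Rightarrow> 'k rel \<Rightarrow> ('f, 'r, 'm) struct \<Rightarrow> bool" where
  "monster_model L T \<kappa> M \<longleftrightarrow> is_model M T
     \<and> Card_order \<kappa> \<and> natLeq <o \<kappa> \<and> |funs L| <o \<kappa> \<and> |rels L| <o \<kappa>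
     \<and> saturated L \<kappa> M \<and> strongly_homogeneous L \<kappa> M"

text \<open>
  A formula \<open>\<phi>(x, y)\<close> has its variables \<open>x\<close> tagged with \<^const>\<open>Inl\<close> and its variables \<open>y\<close> tagged
  with \<^const>\<open>Inr\<close>; \<open>inst a \<phi>\<close> is \<open>\<phi>(a, y)\<close>.
\<close>

primrec inst_tm :: "'m list \<Rightarrow> ('f, nat + 'v, 'm) tm \<Rightarrow> ('f, 'v, 'm) tm" where
  "inst_tm a (BVar j) = BVar j"
| "inst_tm a (FVar z) = (case z of Inl k \<Rightarrow> Param (a ! k) | Inr y \<Rightarrow> FVar y)"
| "inst_tm a (Param m) = Param m"
| "inst_tm a (Fun f ts) = Fun f (map (inst_tm a) ts)"

primrec inst :: "'m list \<Rightarrow> ('f, 'r, nat + 'v, 'm) fm \<Rightarrow> ('f, 'r, 'v, 'm) fm" where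
  "inst a (Eq s t) = Eq (inst_tm a s) (inst_tm a t)"
| "inst a (Rel r ts) = Rel r (map (inst_tm a) ts)"
| "inst a (Neg \<phi>) = Neg (inst a \<phi>)"
| "inst a (Conj \<phi> \<psi>) = Conj (inst a \<phi>) (inst a \<psi>)"
| "inst a (Exist \<phi>) = Exist (inst a \<phi>)"

definition Fml2 :: "('f, 'r) lang \<Rightarrow> nat \<Rightarrow> 'v set \<Rightarrow> ('f, 'r, nat + 'v, 'm) fm set" where
  "Fml2 L n Y = Fml L ({..<n} <+> Y) {}"

definition copies :: "('f, 'r) lang \<Rightarrow> ('f, 'r, 'm) struct \<Rightarrow> 'm set \<Rightarrow> 'm list \<Rightarrow> 'm list set" where
  "copies L M S a = {a'. set a' \<subseteq> S \<and> same_type L M a' a}"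

definition coloring ::
  "('f, 'r) lang \<Rightarrow> ('f, 'r, 'm) struct \<Rightarrow> 'm list \<Rightarrow> nat \<Rightarrow> ('m list \<Rightarrow> nat \<Rightarrow> nat) \<Rightarrow> bool" where
  "coloring L M a n col \<longleftrightarrow> col \<in> copies L M UNIV a \<rightarrow> ({..<n} \<rightarrow>\<^sub>E {0, 1})"

definition externally_definable ::
  "('f, 'r) lang \<Rightarrow> ('f, 'r, 'm) struct \<Rightarrow> 'm list \<Rightarrow> nat \<Rightarrow> ('m list \<Rightarrow> nat \<Rightarrow> nat) \<Rightarrow> bool" where
  "externally_definable L M a n col \<longleftrightarrow>
     (\<exists>(m::nat) \<phi> p. \<forall>i<n. \<phi> i \<in> Fml2 L (length a) {..<m} \<and> p i \<in> ctypes L M {..<m} UNIV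
        \<and> (\<forall>a'\<in>copies L M UNIV a. col a' i = 1 \<longleftrightarrow> inst a' (\<phi> i) \<in> p i))"

definition monochromatic :: "('a \<Rightarrow> 'b) \<Rightarrow> 'a set \<Rightarrow> bool" where
  "monochromatic col S \<longleftrightarrow> (\<exists>x. col ` S = {x})"

definition type_EDEERP ::
  "('f, 'r) lang \<Rightarrow> ('f, 'r, 'm) struct \<Rightarrow> nat \<Rightarrow> ('f, 'r, nat, 'm) fm set \<Rightarrow> bool" where
  "type_EDEERP L M k q \<longleftrightarrow> (\<exists>a. realizes M k a q
     \<and> (\<forall>b n col. set a \<subseteq> set b \<and> coloring L M a n col \<and> externally_definable L M a n col \<longrightarrow>
          (\<exists>b'\<in>copies L M UNIV b. monochromatic col (copies L M (set b') a))))"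

text \<open>The property of \<open>T\<close>, expressed in its monster model \<open>M\<close>.\<close>

definition theory_EDEERP :: "('f, 'r) lang \<Rightarrow> ('f, 'r, 'm) struct \<Rightarrow> bool" where
  "theory_EDEERP L M \<longleftrightarrow> (\<forall>k. \<forall>q\<in>ctypes L M {..<k} {}. type_EDEERP L M k q)"

text \<open>
  The space of global types extending the type of \<open>c\<close> over the empty set. The variables are the
  indices of \<open>c\<close>.
\<close>

definition Sc :: "('f, 'r) lang \<Rightarrow> ('f, 'r, 'm) struct \<Rightarrow> ('i \<Rightarrow> 'm) \<Rightarrow> ('f, 'r, 'i, 'm) fm set set" where
  "Sc L M c = {p \<in> ctypes L M UNIV UNIV. {\<phi> \<in> Fml L UNIV {}. sat M c \<phi>} \<subseteq> p}"

definition Sc_topology ::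
  "('f, 'r) lang \<Rightarrow> ('f, 'r, 'm) struct \<Rightarrow> ('i \<Rightarrow> 'm) \<Rightarrow> ('f, 'r, 'i, 'm) fm set topology" where
  "Sc_topology L M c = topology_generated_by ((\<lambda>\<phi>. {p \<in> Sc L M c. \<phi> \<in> p}) ` Fml L UNIV UNIV)"

lemma topspace_Sc_topology:
  fixes L :: "('f, 'r) lang" and M :: "('f, 'r, 'm) struct" and c :: "'i \<Rightarrow> 'm"
  shows "topspace (Sc_topology L M c) = Sc L M c"
proof -
  define \<theta> :: "('f, 'r, 'i, 'm) fm" where "\<theta> = Eq (Param undefined) (Param undefined)"
  have "\<theta> \<in> Fml L UNIV UNIV" "Neg \<theta> \<in> Fml L UNIV UNIV"
    by (simp_all add: \<theta>_def Fml_def)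
  moreover from this have "\<theta> \<in> p \<or> Neg \<theta> \<in> p" if "p \<in> Sc L M c" for p
    using that by (auto simp: Sc_def ctypes_def)
  ultimately show ?thesis
    unfolding Sc_topology_def topology_generated_by_topspace by blast
qed

definition act_type :: "('m \<Rightarrow> 'm) \<Rightarrow> ('f, 'r, 'i, 'm) fm set \<Rightarrow> ('f, 'r, 'i, 'm) fm set" where
  "act_type \<sigma> p = map_fm id \<sigma> ` p"

text \<open>The underlying set of the Ellis semigroup, in the space of extensional functions \<open>X \<rightarrow> X\<close>.\<close>

definition Ellis :: "'x topology \<Rightarrow> 'g set \<Rightarrow> ('g \<Rightarrow> 'x \<Rightarrow> 'x) \<Rightarrow> ('x \<Rightarrow> 'x) set" where
  "Ellis X G act = product_topology (\<lambda>_. X) (topspace X) closure_of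
     ((\<lambda>g. restrict (act g) (topspace X)) ` G)"

definition EL_Sc ::
  "('f, 'r) lang \<Rightarrow> ('f, 'r, 'm) struct \<Rightarrow> ('i \<Rightarrow> 'm) \<Rightarrow>
     (('f, 'r, 'i, 'm) fm set \<Rightarrow> ('f, 'r, 'i, 'm) fm set) set" where
  "EL_Sc L M c = Ellis (Sc_topology L M c) (Aut L M) act_type"

definition Inv_c ::
  "('f, 'r) lang \<Rightarrow> ('f, 'r, 'm) struct \<Rightarrow> ('i \<Rightarrow> 'm) \<Rightarrow> ('f, 'r, 'i, 'm) fm set set" where
  "Inv_c L M c = {p \<in> Sc L M c. \<forall>\<sigma>\<in>Aut L M. act_type \<sigma> p = p}"

definition Inv_qc ::
  "('f, 'r) lang \<Rightarrow> ('f, 'r, 'm) struct \<Rightarrow> nat \<Rightarrow> ('f, 'r, nat, 'm) fm set \<Rightarrow> ('i \<Rightarrow> 'm) \<Rightarrow>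
     ('f, 'r, 'i, 'm) fm set set" where
  "Inv_qc L M k q c = {p \<in> Sc L M c. \<forall>\<phi>\<in>Fml2 L k UNIV. \<forall>a a'.
     realizes M k a q \<and> realizes M k a' q \<longrightarrow> (inst a \<phi> \<in> p \<longleftrightarrow> inst a' \<phi> \<in> p)}"

end

theory Submission
  imports Defs
begin

text \<open>
  Acting by an automorphism \<open>\<sigma>\<close> on a type \<open>P\<close> recolors a tuple \<open>a\<close> with the color of \<open>\<sigma>\<^sup>-\<^sup>1 a\<close>, so a
  copy of \<open>b\<close> on which finitely many externally definable colorings are constant corresponds to an
  automorphism after which the given types do not distinguish the copies of \<open>a\<close> in \<open>b\<close>. A limit of such
  automorphisms along an ultrafilter is an element of the Ellis semigroup whose image consists of
  invariant types. Conversely, an element of the Ellis semigroup is approximated on finitely many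
  types and formulas by an automorphism \<open>\<sigma>\<close>, and \<open>\<sigma>\<^sup>-\<^sup>1 b\<close> is then the required copy of \<open>b\<close>; here types in
  finitely many variables are first extended to types extending that of \<open>c\<close>.
\<close>

section \<open>Ultrafilters\<close>

text \<open>Formulated on the type of filters, so that \<open>eventually\<close> and convergence by
  \<open>limitin\<close> apply to ultrafilters directly.\<close>

definition ultra :: "'a filter \<Rightarrow> bool" where
  "ultra U \<longleftrightarrow> U \<noteq> bot \<and> (\<forall>P. eventually P U \<or> eventually (\<lambda>x. \<not> P x) U)"

lemma ultra_eventually_not:
  assumes "ultra U"
  shows "eventually (\<lambda>x. \<not> P x) U \<longleftrightarrow> \<not> eventually P U"
proof
  assume not_P: "eventually (\<lambda>x. \<not> P x) U"
  show "\<not> eventually P U"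
  proof
    assume "eventually P U"
    with not_P have "eventually (\<lambda>x. False) U" by eventually_elim simp
    then show False using assms by (simp add: ultra_def trivial_limit_def)
  qed
qed (use assms in \<open>auto simp: ultra_def\<close>)

text \<open>Smaller filters are finer, so Zorn's lemma is applied to the proper filters below
  \<open>F\<close> with the order reversed; a minimal proper filter decides every predicate.\<close>

lemma ultrafilter_exists:
  fixes F :: "'a filter"
  assumes "F \<noteq> bot"
  obtains U where "ultra U" "U \<le> F"
proof -
  let ?A = "{G. G \<noteq> bot \<and> G \<le> F}"
  have "\<exists>U\<in>?A. \<forall>G\<in>?A. U \<ge> G \<longrightarrow> G = U"
  proof (rule predicate_Zorn)
    show "partial_order_on ?A (relation_of (\<lambda>G H. G \<ge> H) ?A)"
      by (rule partial_order_on_relation_ofI) auto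
  next
    fix C assume C: "C \<in> Chains (relation_of (\<lambda>G H. G \<ge> H) ?A)"
    then have CA: "C \<subseteq> ?A" and tot: "\<And>G H. G \<in> C \<Longrightarrow> H \<in> C \<Longrightarrow> G \<le> H \<or> H \<le> G"
      by (auto simp: Chains_def relation_of_def)
    show "\<exists>U\<in>?A. \<forall>G\<in>C. G \<ge> U"
    proof (cases "C = {}")
      case True then show ?thesis using assms by auto
    next
      case False
      \<comment> \<open>What holds eventually along the infimum of a nonempty chain already holds
        eventually along one member, so properness is inherited.\<close>
      have "Inf C \<noteq> bot"
      proof
        assume "Inf C = bot"
        then have "eventually (\<lambda>_. False) (Inf C)" by simp
        then have "\<exists>G\<in>C. eventually (\<lambda>_. False) G"
          using False tot by (subst (asm) eventually_Inf_base) (metis inf.absorb1 inf.absorb2 order_refl)+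
        then show False using CA by (auto simp: trivial_limit_def)
      qed
      moreover have "Inf C \<le> F" using False CA by (auto intro: Inf_lower2)
      ultimately show ?thesis by (auto intro: Inf_lower)
    qed
  qed
  then obtain U where U: "U \<noteq> bot" "U \<le> F"
    and max: "\<And>G. G \<noteq> bot \<Longrightarrow> G \<le> F \<Longrightarrow> G \<le> U \<Longrightarrow> G = U" by auto
  \<comment> \<open>Either \<open>P\<close> is incompatible with \<open>U\<close>, and its negation
    is eventually true, or adding \<open>P\<close> keeps the filter proper and minimality says that
    nothing was added.\<close>
  have "eventually P U \<or> eventually (\<lambda>x. \<not> P x) U" for P
  proof (cases "inf U (principal {x. P x}) = bot")
    case True
    then have "eventually (\<lambda>_. False) (inf U (principal {x. P x}))" by simp
    then show ?thesis by (simp add: eventually_inf_principal)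
  next
    case False
    then have "inf U (principal {x. P x}) = U"
      by (intro max) (use U in \<open>auto intro: le_infI1\<close>)
    then have "U \<le> principal {x. P x}" by (metis inf.absorb_iff1)
    then show ?thesis by (simp add: le_principal)
  qed
  then show thesis using that U by (auto simp: ultra_def)
qed

text \<open>The parts of \<open>G\<close> cut out by the conditions \<open>R d\<close> have the
  finite intersection property, so they generate a proper filter. Both compactness arguments below
  rest on this: one for valuations, one for automorphisms.\<close>

lemma ultrafilter_of_finite_intersections:
  assumes "\<And>F. finite F \<Longrightarrow> F \<subseteq> D \<Longrightarrow> \<exists>x\<in>G. \<forall>d\<in>F. R d x"
  obtains U where "ultra U" "eventually (\<lambda>x. x \<in> G) U" "\<And>d. d \<in> D \<Longrightarrow> eventually (R d) U"
proof -
  have "inf (principal G) (INF d\<in>D. principal {x. R d x}) \<noteq> bot"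
  proof
    assume "inf (principal G) (INF d\<in>D. principal {x. R d x}) = bot"
    then have "eventually (\<lambda>x. x \<notin> G) (INF d\<in>D. principal {x. R d x})"
      by (simp add: inf_commute[of "principal G"] trivial_limit_def eventually_inf_principal)
    then obtain F where F: "finite F" "F \<subseteq> D" "eventually (\<lambda>x. x \<notin> G) (INF d\<in>F. principal {x. R d x})"
      unfolding eventually_INF[of _ _ D] by blast
    obtain x where x: "x \<in> G" "\<forall>d\<in>F. R d x" using assms[OF F(1,2)] by blast
    then have "principal {x} \<le> (INF d\<in>F. principal {x. R d x})" by (auto intro!: INF_greatest)
    then have "eventually (\<lambda>x. x \<notin> G) (principal {x})" using F(3) by (rule filter_leD)
    then show False using x(1) by (simp add: eventually_principal)
  qed
  then obtain U where U: "ultra U" "U \<le> inf (principal G) (INF d\<in>D. principal {x. R d x})"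
    by (rule ultrafilter_exists)
  have "eventually (R d) U" if "d \<in> D" for d
  proof -
    have "U \<le> principal {x. R d x}" using U(2) INF_lower[OF that] by (meson le_inf_iff order_trans)
    then show ?thesis by (simp add: le_principal)
  qed
  moreover have "eventually (\<lambda>x. x \<in> G) U" using U(2) by (simp add: le_principal)
  ultimately show thesis using U(1) that by blast
qed

section \<open>Substitution and satisfaction\<close>

lemma eval_cong:
  "(\<And>x. x \<in> fvars_tm t \<Longrightarrow> v x = v' x) \<Longrightarrow> eval M e v t = eval M e v' t"
proof (induction t)
  case (Fun f ts)
  then have "map (eval M e v) ts = map (eval M e v') ts" by (intro map_cong) auto
  then show ?case by (simp cong: map_cong)
qed auto

lemma sat_env_cong:
  "(\<And>x. x \<in> fvars \<phi> \<Longrightarrow> v x = v' x) \<Longrightarrow> sat_env M e v \<phi> = sat_env M e v' \<phi>"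
proof (induction \<phi> arbitrary: e)
  case (Eq s t)
  then have "eval M e v s = eval M e v' s" "eval M e v t = eval M e v' t"
    by (auto intro!: eval_cong)
  then show ?case by simp
next
  case (Rel r ts)
  then have "map (eval M e v) ts = map (eval M e v') ts"
    by (auto intro!: eval_cong)
  then show ?case by (simp cong: map_cong)
qed auto

lemma sat_cong: "(\<And>x. x \<in> fvars \<phi> \<Longrightarrow> v x = v' x) \<Longrightarrow> sat M v \<phi> = sat M v' \<phi>"
  unfolding sat_def by (rule sat_env_cong)

lemma eval_map_fvars: "eval M e v (map_tm f id t) = eval M e (v \<circ> f) t"
  by (induction t) (auto cong: map_cong simp: comp_def)

lemma sat_env_map_fvars: "sat_env M e v (map_fm f id \<phi>) = sat_env M e (v \<circ> f) \<phi>"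
  by (induction \<phi> arbitrary: e) (simp_all add: eval_map_fvars[unfolded comp_def] comp_def)

lemma sat_map_fvars: "sat M v (map_fm f id \<phi>) = sat M (v \<circ> f) \<phi>"
  unfolding sat_def by (rule sat_env_map_fvars)

lemma eval_bvars_cong:
  "wf_tm L k t \<Longrightarrow> (\<And>j. j < k \<Longrightarrow> e j = e' j) \<Longrightarrow> eval M e v t = eval M e' v t"
proof (induction t)
  case (Fun f ts)
  then have "map (eval M e v) ts = map (eval M e' v) ts"
    by (intro map_cong) (auto simp: list_all_iff)
  then show ?case by (simp cong: map_cong)
qed auto

lemma sat_env_bvars_cong:
  "wf_fm L k \<phi> \<Longrightarrow> (\<And>j. j < k \<Longrightarrow> e j = e' j) \<Longrightarrow> sat_env M e v \<phi> = sat_env M e' v \<phi>"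
proof (induction \<phi> arbitrary: e e' k)
  case (Eq s t)
  then have "eval M e v s = eval M e' v s" "eval M e v t = eval M e' v t"
    by (auto intro!: eval_bvars_cong)
  then show ?case by simp
next
  case (Rel r ts)
  then have "map (eval M e v) ts = map (eval M e' v) ts"
    by (auto intro!: eval_bvars_cong simp: list_all_iff)
  then show ?case by (simp cong: map_cong)
next
  case (Conj \<phi> \<psi>)
  show ?case using Conj.IH[of k e e'] Conj.prems by simp
next
  case (Neg \<phi>)
  show ?case using Neg.IH[of k e e'] Neg.prems by simp
next
  case (Exist \<phi>)
  have "sat_env M (case_nat x e) v \<phi> = sat_env M (case_nat x e') v \<phi>" for x
    by (rule Exist.IH[of "Suc k"]) (use Exist.prems in \<open>auto split: nat.split\<close>)
  then show ?case by simp
qed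

section \<open>Renaming of variables and parameters\<close>

lemma wf_tm_map [simp]: "wf_tm L k (map_tm f g t) = wf_tm L k t"
  by (induction t) (auto simp: list_all_iff)

lemma wf_fm_map [simp]: "wf_fm L k (map_fm f g \<phi>) = wf_fm L k \<phi>"
  by (induction \<phi> arbitrary: k) (auto simp: list_all_iff)

lemma map_fm_in_Fml:
  "\<phi> \<in> Fml L X A \<Longrightarrow> f ` X \<subseteq> Y \<Longrightarrow> g ` A \<subseteq> B \<Longrightarrow> map_fm f g \<phi> \<in> Fml L Y B"
  by (fastforce simp: Fml_def fm.set_map)

lemma Neg_in_Fml [simp]: "Neg \<phi> \<in> Fml L X A \<longleftrightarrow> \<phi> \<in> Fml L X A"
  by (simp add: Fml_def)

lemma sat_Neg [simp]: "sat M v (Neg \<phi>) \<longleftrightarrow> \<not> sat M v \<phi>"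
  by (simp add: sat_def)

lemma Fml_mono: "\<phi> \<in> Fml L X A \<Longrightarrow> X \<subseteq> Y \<Longrightarrow> A \<subseteq> B \<Longrightarrow> \<phi> \<in> Fml L Y B"
  by (auto simp: Fml_def)

lemma finite_fvars_tm [simp]: "finite (fvars_tm t)"
  by (induction t) auto

lemma finite_fvars [simp]: "finite (fvars \<phi>)"
  by (induction \<phi>) auto

lemma finite_params_tm [simp]: "finite (params_tm t)"
  by (induction t) auto

lemma finite_params [simp]: "finite (params \<phi>)"
  by (induction \<phi>) auto

lemma map_params_empty: "params \<phi> = {} \<Longrightarrow> map_fm id \<sigma> \<phi> = \<phi>"
  using fm.map_cong0[of \<phi> id id \<sigma> id] by (simp add: fm.map_id)

section \<open>Instantiation of variables by a tuple, and its reversal\<close>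

lemma inst_tm_map_fvars: "map_tm f id (inst_tm a t) = inst_tm a (map_tm (map_sum id f) id t)"
  by (induction t) (auto split: sum.split)

lemma inst_map_fvars: "map_fm f id (inst a \<phi>) = inst a (map_fm (map_sum id f) id \<phi>)"
  by (induction \<phi>) (auto simp: inst_tm_map_fvars[unfolded id_def])

text \<open>Once \<open>t\<close> has no parameters of its own, \<open>\<sigma>\<close> acts only on
  the entries of \<open>a\<close>. The bound on the variables matters because
  \<open>map \<sigma> a ! k\<close> is \<open>\<sigma> (a ! k)\<close> only for
  \<open>k < length a\<close>.\<close>

lemma inst_tm_map_params:
  "fvars_tm t \<subseteq> {..<length a} <+> Y \<Longrightarrow> params_tm t = {} \<Longrightarrow>
    map_tm id \<sigma> (inst_tm a t) = inst_tm (map \<sigma> a) t"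
  by (induction t) (auto split: sum.split simp: UN_subset_iff)

lemma inst_map_params:
  "fvars \<phi> \<subseteq> {..<length a} <+> Y \<Longrightarrow> params \<phi> = {} \<Longrightarrow>
    map_fm id \<sigma> (inst a \<phi>) = inst (map \<sigma> a) \<phi>"
  by (induction \<phi>) (auto simp: UN_subset_iff intro!: inst_tm_map_params)

lemma wf_inst_tm [simp]: "wf_tm L k (inst_tm a t) = wf_tm L k t"
  by (induction t) (auto simp: list_all_iff split: sum.split)

lemma wf_inst [simp]: "wf_fm L k (inst a \<phi>) = wf_fm L k \<phi>"
  by (induction \<phi> arbitrary: k) (auto simp: list_all_iff)

lemma fvars_inst_tm: "fvars_tm (inst_tm a t) = {y. Inr y \<in> fvars_tm t}"
  by (induction t) (auto split: sum.split)

lemma fvars_inst: "fvars (inst a \<phi>) = {y. Inr y \<in> fvars \<phi>}"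
  by (induction \<phi>) (auto simp: fvars_inst_tm)

lemma inst_in_Fml: "\<phi> \<in> Fml2 L k Y \<Longrightarrow> inst a \<phi> \<in> Fml L Y UNIV"
  by (auto simp: Fml2_def Fml_def fvars_inst)

text \<open>A right inverse of \<open>inst_tm a\<close> on terms whose parameters all occur in
  \<open>a\<close>. Any position of a parameter will do, since only the entry there is read
  back.\<close>

primrec abstract_tm :: "'m list \<Rightarrow> ('f, 'v, 'm) tm \<Rightarrow> ('f, nat + 'v, 'm) tm" where
  "abstract_tm a (BVar j) = BVar j"
| "abstract_tm a (FVar y) = FVar (Inr y)"
| "abstract_tm a (Param m) = FVar (Inl (SOME i. i < length a \<and> a ! i = m))"
| "abstract_tm a (Fun f ts) = Fun f (map (abstract_tm a) ts)"

primrec abstract_fm :: "'m list \<Rightarrow> ('f, 'r, 'v, 'm) fm \<Rightarrow> ('f, 'r, nat + 'v, 'm) fm" where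
  "abstract_fm a (Eq s t) = Eq (abstract_tm a s) (abstract_tm a t)"
| "abstract_fm a (Rel r ts) = Rel r (map (abstract_tm a) ts)"
| "abstract_fm a (Neg \<phi>) = Neg (abstract_fm a \<phi>)"
| "abstract_fm a (Conj \<phi> \<psi>) = Conj (abstract_fm a \<phi>) (abstract_fm a \<psi>)"
| "abstract_fm a (Exist \<phi>) = Exist (abstract_fm a \<phi>)"

lemma SOME_nth:
  assumes "m \<in> set a"
  shows "(SOME i. i < length a \<and> a ! i = m) < length a" "a ! (SOME i. i < length a \<and> a ! i = m) = m"
  using someI_ex[of "\<lambda>i. i < length a \<and> a ! i = m"] assms by (auto simp: in_set_conv_nth)

lemma abstract_tm:
  "params_tm t \<subseteq> set a \<Longrightarrow> inst_tm a (abstract_tm a t) = t \<and> params_tm (abstract_tm a t) = {}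
    \<and> fvars_tm (abstract_tm a t) \<subseteq> {..<length a} <+> UNIV"
  by (induction t) (auto simp: UN_subset_iff SOME_nth intro!: map_idI)

lemma abstract_fm:
  "params \<phi> \<subseteq> set a \<Longrightarrow> inst a (abstract_fm a \<phi>) = \<phi> \<and> params (abstract_fm a \<phi>) = {}
    \<and> fvars (abstract_fm a \<phi>) \<subseteq> {..<length a} <+> UNIV"
  by (induction \<phi>) (auto simp: UN_subset_iff abstract_tm intro!: map_idI dest!: abstract_tm)

text \<open>With the parameters turned into a tuple of variables, moving them by an automorphism
  becomes replacing one realization of a type by another.\<close>

lemma abstract_params:
  assumes "\<psi> \<in> Fml L UNIV UNIV" "params \<psi> \<subseteq> set a"
  obtains \<phi> where "\<phi> \<in> Fml2 L (length a) UNIV" "inst a \<phi> = \<psi>"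
proof
  have *: "inst a (abstract_fm a \<psi>) = \<psi>" using abstract_fm[OF assms(2)] by blast
  then show "inst a (abstract_fm a \<psi>) = \<psi>" .
  have "wf_fm L 0 (abstract_fm a \<psi>)" using assms(1) * wf_inst[of L 0 a "abstract_fm a \<psi>"]
    by (simp add: Fml_def)
  then show "abstract_fm a \<psi> \<in> Fml2 L (length a) UNIV"
    using abstract_fm[OF assms(2)] by (simp add: Fml2_def Fml_def)
qed

section \<open>Automorphisms\<close>

text \<open>Elements enter a term through indices, variables and parameters, and
  \<open>\<sigma>\<close> has to move all three. Well-formedness is used because \<open>Aut\<close>
  constrains \<open>\<sigma>\<close> only at symbols of the language with their own arity.\<close>

lemma eval_aut:
  "\<sigma> \<in> Aut L M \<Longrightarrow> wf_tm L k t \<Longrightarrow> eval M (\<sigma> \<circ> e) (\<sigma> \<circ> v) (map_tm id \<sigma> t) = \<sigma> (eval M e v t)"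
proof (induction t)
  case (Fun f ts)
  then have "map (\<lambda>t. eval M (\<sigma> \<circ> e) (\<sigma> \<circ> v) (map_tm id \<sigma> t)) ts = map (\<lambda>t. \<sigma> (eval M e v t)) ts"
    by (intro map_cong Fun.IH) (simp_all add: list_all_iff)
  with Fun.prems show ?case by (simp add: Aut_def comp_def id_def cong: map_cong)
qed auto

text \<open>Injectivity of \<open>\<sigma>\<close> gives the case of equality; surjectivity gives
  the quantifier, as every witness has the form \<open>\<sigma> x\<close>.\<close>

lemma sat_env_aut:
  "\<sigma> \<in> Aut L M \<Longrightarrow> wf_fm L k \<phi> \<Longrightarrow>
    sat_env M (\<sigma> \<circ> e) (\<sigma> \<circ> v) (map_fm id \<sigma> \<phi>) = sat_env M e v \<phi>"
proof (induction \<phi> arbitrary: e k)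
  case (Eq s t)
  then have "inj \<sigma>" by (auto simp: Aut_def bij_def)
  with Eq show ?case by (simp add: eval_aut[where L = L and k = k, unfolded comp_def id_def] inj_eq)
next
  case (Rel r ts)
  then have "map (\<lambda>t. eval M (\<sigma> \<circ> e) (\<sigma> \<circ> v) (map_tm id \<sigma> t)) ts = map (\<lambda>t. \<sigma> (eval M e v t)) ts"
    by (intro map_cong eval_aut[where k = k]) (auto simp: list_all_iff)
  moreover have "rel_int M r (map \<sigma> xs) = rel_int M r xs" if "length xs = length ts" for xs
    using Rel.prems that by (simp add: Aut_def)
  from this[of "map (eval M e v) ts"]
  have "rel_int M r (map (\<lambda>t. \<sigma> (eval M e v t)) ts) = rel_int M r (map (eval M e v) ts)"
    by (simp add: comp_def)
  ultimately show ?case by (simp add: comp_def id_def cong: map_cong)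
next
  case (Exist \<phi>)
  have *: "case_nat (\<sigma> x) (\<sigma> \<circ> e) = \<sigma> \<circ> case_nat x e" for x
    by (auto split: nat.split)
  have "surj \<sigma>" using Exist.prems by (auto simp: Aut_def bij_def)
  then have **: "(\<exists>y. Q y) \<longleftrightarrow> (\<exists>x. Q (\<sigma> x))" for Q by (metis surj_def)
  have "sat_env M (\<sigma> \<circ> e) (\<sigma> \<circ> v) (map_fm id \<sigma> (Exist \<phi>)) \<longleftrightarrow>
      (\<exists>y. sat_env M (case_nat y (\<sigma> \<circ> e)) (\<sigma> \<circ> v) (map_fm id \<sigma> \<phi>))"
    by (simp add: comp_def id_def)
  also have "\<dots> \<longleftrightarrow> (\<exists>x. sat_env M (\<sigma> \<circ> case_nat x e) (\<sigma> \<circ> v) (map_fm id \<sigma> \<phi>))"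
    unfolding *[symmetric] by (rule **)
  also have "\<dots> \<longleftrightarrow> sat_env M e v (Exist \<phi>)"
    using Exist.prems by (simp only: Exist.IH[of "Suc k"] wf_fm.simps sat_env.simps)
  finally show ?case .
qed auto

lemma sat_aut:
  assumes "\<sigma> \<in> Aut L M" "\<phi> \<in> Fml L X A"
  shows "sat M (\<sigma> \<circ> v) (map_fm id \<sigma> \<phi>) = sat M v \<phi>"
proof -
  \<comment> \<open>\<open>\<sigma>\<close> may move the default value \<open>undefined\<close> of
    the indices, but a formula without loose indices does not see this.\<close>
  have "sat M (\<sigma> \<circ> v) (map_fm id \<sigma> \<phi>) = sat_env M (\<sigma> \<circ> (\<lambda>_. undefined)) (\<sigma> \<circ> v) (map_fm id \<sigma> \<phi>)"
    unfolding sat_def by (rule sat_env_bvars_cong[of L 0]) (use assms in \<open>auto simp: Fml_def\<close>)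
  also have "\<dots> = sat M v \<phi>"
    unfolding sat_def by (rule sat_env_aut) (use assms in \<open>auto simp: Fml_def\<close>)
  finally show ?thesis .
qed

lemma sat_aut_pure:
  assumes "\<sigma> \<in> Aut L M" "\<phi> \<in> Fml L X {}"
  shows "sat M (\<sigma> \<circ> v) \<phi> = sat M v \<phi>"
  using sat_aut[OF assms] assms(2) by (simp add: Fml_def map_params_empty)

section \<open>Tuples of equal type and their conjugacy under automorphisms\<close>

lemma same_type_sym: "same_type L M a b \<Longrightarrow> same_type L M b a"
  by (auto simp: same_type_def)

lemma same_type_trans: "same_type L M a b \<Longrightarrow> same_type L M b d \<Longrightarrow> same_type L M a d"
  by (auto simp: same_type_def)

lemma same_type_aut:
  assumes "\<sigma> \<in> Aut L M"
  shows "same_type L M a (map \<sigma> a)"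
proof -
  have "sat M (nth (map \<sigma> a)) \<phi> = sat M (nth a) \<phi>" if "\<phi> \<in> Fml L {..<length a} {}" for \<phi>
  proof -
    have "sat M (nth (map \<sigma> a)) \<phi> = sat M (\<sigma> \<circ> nth a) \<phi>"
      by (rule sat_cong) (use that in \<open>auto simp: Fml_def\<close>)
    then show ?thesis using sat_aut_pure[OF assms that] by simp
  qed
  then show ?thesis by (simp add: same_type_def)
qed

text \<open>Sending \<open>a ! i\<close> to \<open>a' ! i\<close> is an elementary map on a finite
  set, which homogeneity extends to an automorphism.\<close>

lemma same_type_conj_aut:
  assumes hom: "strongly_homogeneous L \<kappa> M" and inf: "Card_order \<kappa>" "natLeq <o \<kappa>"
    and st: "same_type L M a a'"
  obtains \<sigma> where "\<sigma> \<in> Aut L M" "map \<sigma> a = a'"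
proof -
  have len: "length a = length a'" using st by (simp add: same_type_def)
  \<comment> \<open>The equations between two variables belong to the type, so entries repeat at the
    same positions in both tuples and the correspondence is well defined.\<close>
  have eq: "a ! i = a ! j \<longleftrightarrow> a' ! i = a' ! j" if "i < length a" "j < length a" for i j
  proof -
    have "Eq (FVar i) (FVar j) \<in> Fml L {..<length a} {}" using that by (simp add: Fml_def)
    with st have "sat M (nth a) (Eq (FVar i) (FVar j)) = sat M (nth a') (Eq (FVar i) (FVar j))"
      unfolding same_type_def by blast
    then show ?thesis by (simp add: sat_def)
  qed
  define ix where "ix m = (SOME i. i < length a \<and> a ! i = m)" for m
  define g where "g m = a' ! ix m" for m
  have ix: "ix m < length a" "a ! ix m = m" if "m \<in> set a" for m
    unfolding ix_def using SOME_nth[OF that] by auto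
  have g: "g (a ! i) = a' ! i" if "i < length a" for i
    unfolding g_def using eq[of "ix (a ! i)" i] ix[of "a ! i"] that by simp
  have "elementary_map L M (set a) g"
    unfolding elementary_map_def same_type_def
  proof (intro allI impI conjI ballI)
    fix d and \<phi> :: "('a, 'b, nat, 'd) fm"
    assume d: "set d \<subseteq> set a" and \<phi>: "\<phi> \<in> Fml L {..<length d} {}"
    \<comment> \<open>A statement about \<open>d\<close> becomes one about \<open>a\<close> when
      each variable is replaced by a position in \<open>a\<close> of the entry of \<open>d\<close>
      it stands for.\<close>
    let ?h = "\<lambda>l. if l < length d then ix (d ! l) else l"
    let ?\<psi> = "map_fm ?h id \<phi>"
    have dl: "d ! l \<in> set a" if "l < length d" for l using that d by auto
    have v: "l < length d" if "l \<in> fvars \<phi>" for l using that \<phi> by (auto simp: Fml_def)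
    have "?\<psi> \<in> Fml L {..<length a} {}"
      using \<phi> v ix(1) dl by (auto simp: Fml_def fm.set_map)
    then have "sat M (nth a) ?\<psi> = sat M (nth a') ?\<psi>" using st by (simp add: same_type_def)
    moreover have "sat M (nth a) ?\<psi> = sat M (nth d) \<phi>"
      unfolding sat_map_fvars by (rule sat_cong) (use v ix(2) dl in auto)
    moreover have "sat M (nth a') ?\<psi> = sat M (nth (map g d)) \<phi>"
      unfolding sat_map_fvars by (rule sat_cong) (use v in \<open>auto simp: g_def\<close>)
    ultimately show "sat M (nth d) \<phi> = sat M (nth (map g d)) \<phi>" by simp
  qed simp
  moreover have "|set a| <o \<kappa>"
    using inf finite_iff_ordLess_natLeq[of "set a"] by (meson List.finite_set ordLess_transitive)
  ultimately obtain \<sigma> where \<sigma>: "\<sigma> \<in> Aut L M" "\<forall>x\<in>set a. \<sigma> x = g x"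
    using hom unfolding strongly_homogeneous_def by blast
  have "map \<sigma> a = a'" using \<sigma>(2) g len by (auto simp: list_eq_iff_nth_eq)
  with \<sigma>(1) show thesis by (rule that)
qed

section \<open>Complete types\<close>

lemma ctypes_Fml: "p \<in> ctypes L M X A \<Longrightarrow> \<phi> \<in> p \<Longrightarrow> \<phi> \<in> Fml L X A"
  by (auto simp: ctypes_def)

lemma ctypes_finitely_sat:
  "p \<in> ctypes L M X A \<Longrightarrow> finite F \<Longrightarrow> F \<subseteq> p \<Longrightarrow> \<exists>v. \<forall>\<phi>\<in>F. sat M v \<phi>"
  by (auto simp: ctypes_def)

lemma ctypes_Neg:
  assumes "p \<in> ctypes L M X A" "\<phi> \<in> Fml L X A"
  shows "Neg \<phi> \<in> p \<longleftrightarrow> \<phi> \<notin> p"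
proof
  assume "Neg \<phi> \<in> p"
  then show "\<phi> \<notin> p" using ctypes_finitely_sat[OF assms(1), of "{\<phi>, Neg \<phi>}"] by auto
qed (use assms in \<open>auto simp: ctypes_def\<close>)

lemma ctypes_Int_Fml:
  assumes "p \<in> ctypes L M X B" "A \<subseteq> B"
  shows "p \<inter> Fml L X A \<in> ctypes L M X A"
  unfolding ctypes_def
proof (intro CollectI conjI allI impI ballI)
  fix F assume "finite F \<and> F \<subseteq> p \<inter> Fml L X A"
  then show "\<exists>v. \<forall>\<phi>\<in>F. sat M v \<phi>" using ctypes_finitely_sat[OF assms(1)] by blast
next
  fix \<phi> assume \<phi>: "\<phi> \<in> Fml L X A"
  then have "\<phi> \<in> Fml L X B" using assms(2) Fml_mono by blast
  with \<phi> show "\<phi> \<in> p \<inter> Fml L X A \<or> Neg \<phi> \<in> p \<inter> Fml L X A"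
    using ctypes_Neg[OF assms(1)] by auto
qed simp

text \<open>Choose an ultrafilter on valuations along which every formula of \<open>\<Gamma>\<close>
  is eventually true; the formulas eventually true along it form the required type.\<close>

lemma ctypes_extend:
  fixes \<Gamma> :: "('f, 'r, 'v, 'm) fm set"
  assumes sub: "\<Gamma> \<subseteq> Fml L X A"
    and fin: "\<And>F. finite F \<Longrightarrow> F \<subseteq> \<Gamma> \<Longrightarrow> \<exists>v. \<forall>\<phi>\<in>F. sat M v \<phi>"
  obtains p where "p \<in> ctypes L M X A" "\<Gamma> \<subseteq> p"
proof -
  obtain U where U: "ultra U" and ev: "\<And>\<phi>. \<phi> \<in> \<Gamma> \<Longrightarrow> eventually (\<lambda>v. sat M v \<phi>) U"
    using ultrafilter_of_finite_intersections[of \<Gamma> UNIV "\<lambda>\<phi> v. sat M v \<phi>"] fin by auto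
  let ?p = "{\<phi> \<in> Fml L X A. eventually (\<lambda>v. sat M v \<phi>) U}"
  have "?p \<in> ctypes L M X A"
    unfolding ctypes_def
  proof (intro CollectI conjI allI impI ballI)
    fix F assume "finite F \<and> F \<subseteq> ?p"
    then have "eventually (\<lambda>v. \<forall>\<phi>\<in>F. sat M v \<phi>) U" by (auto intro!: eventually_ball_finite)
    then show "\<exists>v. \<forall>\<phi>\<in>F. sat M v \<phi>" using U by (auto simp: ultra_def dest: eventually_happens)
  next
    fix \<phi> assume "\<phi> \<in> Fml L X A"
    then show "\<phi> \<in> ?p \<or> Neg \<phi> \<in> ?p" using U by (auto simp: ultra_eventually_not)
  qed auto
  moreover have "\<Gamma> \<subseteq> ?p" using sub ev by auto
  ultimately show thesis by (rule that)
qed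

text \<open>Completeness makes \<open>q\<close> the whole type of each of its realizations. This
  links the realizations in \<open>Inv_qc\<close> to the copies that are colored.\<close>

lemma realizes_iff_same_type:
  assumes q: "q \<in> ctypes L M {..<k} {}" and a: "realizes M k a q"
  shows "realizes M k a' q \<longleftrightarrow> same_type L M a' a"
proof
  assume a': "realizes M k a' q"
  have "sat M (nth a') \<phi> = sat M (nth a) \<phi>" if "\<phi> \<in> Fml L {..<k} {}" for \<phi>
    using a a' ctypes_Neg[OF q that] unfolding realizes_def by (metis sat_Neg)
  then show "same_type L M a' a" using a a' by (simp add: realizes_def same_type_def)
next
  assume "same_type L M a' a"
  then show "realizes M k a' q"
    using a ctypes_Fml[OF q] by (auto simp: realizes_def same_type_def)
qed

lemma type_of_tuple:
  assumes "length a = k"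
  shows "{\<phi> \<in> Fml L {..<k} {}. sat M (nth a) \<phi>} \<in> ctypes L M {..<k} {}"
    and "realizes M k a {\<phi> \<in> Fml L {..<k} {}. sat M (nth a) \<phi>}"
  using assms by (auto simp: ctypes_def realizes_def)

section \<open>The action of automorphisms on global types\<close>

lemma Sc_ctypes: "P \<in> Sc L M c \<Longrightarrow> P \<in> ctypes L M UNIV UNIV"
  by (simp add: Sc_def)

lemma map_fm_mem_act_type:
  fixes \<psi> :: "('f, 'r, 'i, 'm) fm"
  assumes "\<sigma> \<in> Aut L M"
  shows "map_fm id \<sigma> \<psi> \<in> act_type \<sigma> P \<longleftrightarrow> \<psi> \<in> P"
proof -
  have "inj (map_fm id \<sigma> :: ('f, 'r, 'i, 'm) fm \<Rightarrow> _)"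
    using assms by (intro fm.inj_map) (auto simp: Aut_def bij_def)
  then show ?thesis unfolding act_type_def by (rule inj_image_mem_iff)
qed

text \<open>\<open>\<sigma>\<close> moves the instantiated tuple along with the formula. Hence the
  coloring given by a moved type is the original coloring read at preimages of tuples.\<close>

lemma inst_mem_act_type:
  assumes "\<sigma> \<in> Aut L M" "\<phi> \<in> Fml2 L (length a) Y"
  shows "inst (map \<sigma> a) \<phi> \<in> act_type \<sigma> P \<longleftrightarrow> inst a \<phi> \<in> P"
proof -
  have "inst (map \<sigma> a) \<phi> = map_fm id \<sigma> (inst a \<phi>)"
    using assms(2) by (intro inst_map_params[symmetric]) (auto simp: Fml2_def Fml_def)
  then show ?thesis using map_fm_mem_act_type[OF assms(1)] by simp
qed

text \<open>Finite satisfiability is carried over by composing valuations with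
  \<open>\<sigma>\<close>, completeness by pulling formulas back along \<open>inv \<sigma>\<close>;
  the type of \<open>c\<close> survives because formulas without parameters are fixed.\<close>

lemma act_type_Sc:
  assumes \<sigma>: "\<sigma> \<in> Aut L M" and P: "P \<in> Sc L M c"
  shows "act_type \<sigma> P \<in> Sc L M c"
proof -
  note P' = Sc_ctypes[OF P]
  have sub: "act_type \<sigma> P \<subseteq> Fml L UNIV UNIV"
    using ctypes_Fml[OF P'] by (auto simp: act_type_def intro!: map_fm_in_Fml[where X = UNIV and A = UNIV])
  have fin: "\<exists>v. \<forall>\<phi>\<in>F. sat M v \<phi>" if "finite F" "F \<subseteq> act_type \<sigma> P" for F
  proof -
    obtain F' where F': "finite F'" "F' \<subseteq> P" "F = map_fm id \<sigma> ` F'"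
      using \<open>F \<subseteq> act_type \<sigma> P\<close> \<open>finite F\<close> unfolding act_type_def by (meson finite_subset_image)
    obtain v where "\<forall>\<phi>\<in>F'. sat M v \<phi>" using ctypes_finitely_sat[OF P'] F' by blast
    then have "\<forall>\<phi>\<in>F. sat M (\<sigma> \<circ> v) \<phi>"
      using F' ctypes_Fml[OF P'] sat_aut[OF \<sigma>] by blast
    then show ?thesis by blast
  qed
  have compl: "\<phi> \<in> act_type \<sigma> P \<or> Neg \<phi> \<in> act_type \<sigma> P" if "\<phi> \<in> Fml L UNIV UNIV" for \<phi>
  proof -
    let ?\<psi> = "map_fm id (inv \<sigma>) \<phi>"
    have "?\<psi> \<in> Fml L UNIV UNIV" using that by (rule map_fm_in_Fml) auto
    then have "?\<psi> \<in> P \<or> Neg ?\<psi> \<in> P" using ctypes_Neg[OF P'] by blast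
    moreover have "\<sigma> \<circ> inv \<sigma> = id" using \<sigma> by (auto simp: Aut_def bij_def surj_f_inv_f)
    then have "map_fm id \<sigma> ?\<psi> = \<phi>" by (simp add: fm.map_comp fm.map_id)
    moreover then have "map_fm id \<sigma> (Neg ?\<psi>) = Neg \<phi>" by (simp add: id_def)
    ultimately show ?thesis using map_fm_mem_act_type[OF \<sigma>] by metis
  qed
  have "\<phi> \<in> act_type \<sigma> P" if "\<phi> \<in> Fml L UNIV {}" "sat M c \<phi>" for \<phi>
  proof -
    have "\<phi> \<in> P" using P that by (auto simp: Sc_def)
    moreover have "map_fm id \<sigma> \<phi> = \<phi>" using that by (simp add: map_params_empty Fml_def)
    ultimately show ?thesis using map_fm_mem_act_type[OF \<sigma>] by metis
  qed
  then show ?thesis using sub fin compl by (auto simp: Sc_def ctypes_def)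
qed

text \<open>
  Realizing the restriction of \<open>p\<close> to finitely many parameters and moving the realization by
  homogeneity shows that \<open>p\<close> is consistent with the type of \<open>c\<close>, without quantifying out variables.
\<close>

lemma ctypes_lift_Sc:
  fixes c :: "'i \<Rightarrow> 'm" and M :: "('f, 'r, 'm) struct" and m :: nat
  assumes sat: "saturated L \<kappa> M" and hom: "strongly_homogeneous L \<kappa> M"
    and \<kappa>: "Card_order \<kappa>" "natLeq <o \<kappa>" and "surj c"
    and p: "p \<in> ctypes L M {..<m} UNIV"
  obtains j P where "P \<in> Sc L M c"
    "\<And>\<psi>. \<psi> \<in> Fml L {..<m} UNIV \<Longrightarrow> map_fm j id \<psi> \<in> P \<longleftrightarrow> \<psi> \<in> p"
proof -
  have small: "|A| <o \<kappa>" if "finite A" for A :: "'m set"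
    using that \<kappa> finite_iff_ordLess_natLeq[of A] by (meson ordLess_transitive)
  have realize: "\<exists>d. realizes M m d (p \<inter> Fml L {..<m} A)" if "finite A" for A
    using sat ctypes_Int_Fml[OF p, of A] small[OF that] by (auto simp: saturated_def)
  obtain d where d: "realizes M m d (p \<inter> Fml L {..<m} {})" using realize by blast
  \<comment> \<open>Variable \<open>l\<close> is renamed to an index at which \<open>c\<close>
    enumerates \<open>d ! l\<close>, so \<open>c\<close> satisfies the renamed parameter-free part
    of \<open>p\<close>.\<close>
  define j where "j l = inv c (d ! l)" for l
  have cj: "c (j l) = d ! l" for l unfolding j_def by (rule surj_f_inv_f[OF \<open>surj c\<close>])
  let ?T = "{\<phi> \<in> Fml L UNIV {}. sat M c \<phi>}"
  let ?\<Gamma> = "map_fm j id ` p \<union> ?T"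
  have jF: "map_fm j id \<psi> \<in> Fml L UNIV UNIV" if "\<psi> \<in> Fml L {..<m} UNIV" for \<psi>
    using that by (rule map_fm_in_Fml) auto
  have "?\<Gamma> \<subseteq> Fml L UNIV UNIV"
    using jF[OF ctypes_Fml[OF p]] by (auto intro: Fml_mono)
  moreover have "\<exists>v. \<forall>\<phi>\<in>F. sat M v \<phi>" if F: "finite F" "F \<subseteq> ?\<Gamma>" for F
  proof -
    have "finite (F - ?T)" "F - ?T \<subseteq> map_fm j id ` p" using F by auto
    then obtain F' where F': "finite F'" "F' \<subseteq> p" "F - ?T = map_fm j id ` F'"
      by (meson finite_subset_image)
    define A where "A = (\<Union>\<psi>\<in>F'. params \<psi>)"
    have "finite A" using F' by (simp add: A_def)
    then obtain e where e: "realizes M m e (p \<inter> Fml L {..<m} A)" using realize by blast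
    have "realizes M m e (p \<inter> Fml L {..<m} {})"
      using e by (auto simp: realizes_def intro: Fml_mono)
    then have "same_type L M d e"
      using realizes_iff_same_type[OF ctypes_Int_Fml[OF p] d] by (auto intro: same_type_sym)
    then obtain \<sigma> where \<sigma>: "\<sigma> \<in> Aut L M" "map \<sigma> d = e"
      by (rule same_type_conj_aut[OF hom \<kappa>])
    \<comment> \<open>The moved enumeration satisfies both halves of \<open>F\<close>: it takes the
      value \<open>e ! l\<close> at the index \<open>j l\<close> for \<open>l < m\<close>, and
      \<open>\<sigma>\<close> preserves the type of \<open>c\<close>.\<close>
    have "sat M (\<sigma> \<circ> c) (map_fm j id \<psi>)" if "\<psi> \<in> F'" for \<psi>
    proof -
      have "\<psi> \<in> p" and \<psi>: "\<psi> \<in> Fml L {..<m} A"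
        using that F' ctypes_Fml[OF p, of \<psi>] by (auto simp: Fml_def A_def)
      then have "sat M (nth e) \<psi>" using e by (simp add: realizes_def)
      moreover have "sat M (\<sigma> \<circ> c \<circ> j) \<psi> = sat M (nth e) \<psi>"
        by (rule sat_cong) (use \<psi> \<sigma>(2) d in \<open>auto simp: Fml_def cj realizes_def\<close>)
      ultimately show ?thesis by (simp add: sat_map_fvars)
    qed
    moreover have "sat M (\<sigma> \<circ> c) \<phi>" if "\<phi> \<in> ?T" for \<phi>
      using that sat_aut_pure[OF \<sigma>(1)] by blast
    ultimately have "\<forall>\<phi>\<in>map_fm j id ` F' \<union> ?T. sat M (\<sigma> \<circ> c) \<phi>" by blast
    moreover have "F \<subseteq> map_fm j id ` F' \<union> ?T" using F'(3) by blast
    ultimately show ?thesis by blast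
  qed
  ultimately obtain P where P: "P \<in> ctypes L M UNIV UNIV" "?\<Gamma> \<subseteq> P"
    by (rule ctypes_extend)
  have "map_fm j id \<psi> \<in> P \<longleftrightarrow> \<psi> \<in> p" if \<psi>: "\<psi> \<in> Fml L {..<m} UNIV" for \<psi>
  proof
    assume *: "map_fm j id \<psi> \<in> P"
    show "\<psi> \<in> p"
    proof (rule ccontr)
      assume "\<psi> \<notin> p"
      then have "Neg \<psi> \<in> p" using ctypes_Neg[OF p \<psi>] by simp
      then have "Neg (map_fm j id \<psi>) \<in> P" using P(2) by (force simp: id_def)
      then show False using * ctypes_Neg[OF P(1) jF[OF \<psi>]] by simp
    qed
  qed (use P in auto)
  moreover have "P \<in> Sc L M c" using P by (simp add: Sc_def)
  ultimately show thesis using that by blast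
qed

section \<open>The Ellis semigroup\<close>

text \<open>The sets that eventually contain the values of \<open>f\<close> if they contain
  \<open>l\<close> are stable under finite intersections and arbitrary unions, so testing a subbasis
  suffices.\<close>

lemma limitin_topology_generated_by:
  assumes "l \<in> \<Union>B" "\<And>S. S \<in> B \<Longrightarrow> l \<in> S \<Longrightarrow> eventually (\<lambda>x. f x \<in> S) F"
  shows "limitin (topology_generated_by B) f l F"
proof -
  have "l \<in> S \<longrightarrow> eventually (\<lambda>x. f x \<in> S) F" if "generate_topology_on B S" for S
    using that
  proof induction
    case (Int a b)
    then show ?case by (auto intro: eventually_conj)
  next
    case (UN K)
    show ?case
    proof
      assume "l \<in> \<Union>K"
      then obtain S where "S \<in> K" "l \<in> S" by blast
      with UN have "eventually (\<lambda>x. f x \<in> S) F" by blast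
      then show "eventually (\<lambda>x. f x \<in> \<Union>K) F" by (rule eventually_mono) (use \<open>S \<in> K\<close> in blast)
    qed
  qed (use assms(2) in auto)
  then show ?thesis
    using assms(1) by (auto simp: limitin_def openin_topology_generated_by_iff topology_generated_by_topspace)
qed

text \<open>Agreement with \<open>\<eta>\<close> on finitely many pairs is an open condition in the
  product topology, and \<open>\<eta>\<close> lies in the closure of the maps given by
  automorphisms.\<close>

lemma EL_Sc_approx:
  assumes \<eta>: "\<eta> \<in> EL_Sc L M c" and fin: "finite D"
    and D: "\<And>P \<psi>. (P, \<psi>) \<in> D \<Longrightarrow> P \<in> Sc L M c \<and> \<psi> \<in> Fml L UNIV UNIV"
  obtains \<sigma> where "\<sigma> \<in> Aut L M" "\<And>P \<psi>. (P, \<psi>) \<in> D \<Longrightarrow> \<psi> \<in> act_type \<sigma> P \<longleftrightarrow> \<psi> \<in> \<eta> P"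
proof -
  let ?X = "Sc_topology L M c"
  let ?Y = "product_topology (\<lambda>_. ?X) (topspace ?X)"
  note top = topspace_Sc_topology[of L M c]
  have cl: "\<eta> \<in> topspace ?Y"
    "\<And>T. \<eta> \<in> T \<Longrightarrow> openin ?Y T \<Longrightarrow> \<exists>\<sigma>\<in>Aut L M. restrict (act_type \<sigma>) (topspace ?X) \<in> T"
    using \<eta> unfolding EL_Sc_def Ellis_def in_closure_of by blast+
  have \<eta>Sc: "\<eta> P \<in> Sc L M c" if "P \<in> Sc L M c" for P
    using cl(1) that by (auto simp: top PiE_def Pi_def)
  \<comment> \<open>The one of \<open>\<psi>\<close> and its negation that \<open>\<eta> P\<close>
    contains. Requiring it of a type is a basic open condition that decides \<open>\<psi>\<close> as
    \<open>\<eta> P\<close> does.\<close>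
  define \<chi> where "\<chi> P \<psi> = (if \<psi> \<in> \<eta> P then \<psi> else Neg \<psi>)" for P \<psi>
  define W where "W = (\<lambda>(P, \<psi>). {f \<in> topspace ?Y. f P \<in> {p \<in> Sc L M c. \<chi> P \<psi> \<in> p}})"
  have "openin ?Y (W d)" if dD: "d \<in> D" for d
  proof -
    obtain P \<psi> where d: "d = (P, \<psi>)" by fastforce
    then have "P \<in> Sc L M c" "\<chi> P \<psi> \<in> Fml L UNIV UNIV" using dD D by (auto simp: \<chi>_def)
    then have "openin ?X {p \<in> Sc L M c. \<chi> P \<psi> \<in> p}"
      unfolding Sc_topology_def by (intro topology_generated_by_Basis) auto
    then show ?thesis
      unfolding d W_def prod.case
      by (intro openin_continuous_map_preimage[where Y = ?X] continuous_map_product_projection)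
        (use \<open>P \<in> Sc L M c\<close> top in auto)
  qed
  \<comment> \<open>Intersecting with the whole space keeps the set open for empty \<open>D\<close>,
    where the inner intersection is \<open>UNIV\<close>.\<close>
  then have "openin ?Y ((\<Inter>d\<in>D. W d) \<inter> topspace ?Y)" using fin by (intro openin_INT) auto
  moreover have "\<eta> \<in> W d" if dD: "d \<in> D" for d
  proof -
    obtain P \<psi> where d: "d = (P, \<psi>)" by fastforce
    then have *: "P \<in> Sc L M c" "\<psi> \<in> Fml L UNIV UNIV" using dD D by auto
    then have "\<chi> P \<psi> \<in> \<eta> P" using ctypes_Neg[OF Sc_ctypes[OF \<eta>Sc]] by (auto simp: \<chi>_def)
    then show ?thesis using d cl(1) \<eta>Sc[OF *(1)] by (simp add: W_def)
  qed
  ultimately obtain \<sigma> where \<sigma>: "\<sigma> \<in> Aut L M"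
    "restrict (act_type \<sigma>) (topspace ?X) \<in> (\<Inter>d\<in>D. W d) \<inter> topspace ?Y"
    using cl(2)[of "(\<Inter>d\<in>D. W d) \<inter> topspace ?Y"] cl(1) by blast
  have "\<psi> \<in> act_type \<sigma> P \<longleftrightarrow> \<psi> \<in> \<eta> P" if dD: "(P, \<psi>) \<in> D" for P \<psi>
  proof -
    have *: "P \<in> Sc L M c" "\<psi> \<in> Fml L UNIV UNIV" using dD D by auto
    have "restrict (act_type \<sigma>) (topspace ?X) \<in> W (P, \<psi>)" using \<sigma>(2) dD by blast
    then have "\<chi> P \<psi> \<in> act_type \<sigma> P" using * by (simp add: W_def top)
    then show ?thesis
      using ctypes_Neg[OF Sc_ctypes[OF act_type_Sc[OF \<sigma>(1) *(1)]] *(2)]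
      by (auto simp: \<chi>_def split: if_splits)
  qed
  with \<sigma>(1) show thesis by (rule that)
qed

text \<open>
  The limit of automorphisms along an ultrafilter plays the role of compactness of the Ellis semigroup.
\<close>

lemma EL_Sc_limit:
  fixes L :: "('f, 'r) lang" and M :: "('f, 'r, 'm) struct" and c :: "'i \<Rightarrow> 'm"
    and D :: "(('f, 'r, 'i, 'm) fm set \<times> ('f, 'r, 'i, 'm) fm \<times> ('f, 'r, 'i, 'm) fm) set"
  assumes fin: "\<And>F. finite F \<Longrightarrow> F \<subseteq> D \<Longrightarrow>
      \<exists>\<sigma>\<in>Aut L M. \<forall>(P, \<psi>, \<psi>')\<in>F. \<psi> \<in> act_type \<sigma> P \<longleftrightarrow> \<psi>' \<in> act_type \<sigma> P"
    and D: "\<And>P \<psi> \<psi>'. (P, \<psi>, \<psi>') \<in> D \<Longrightarrow> P \<in> Sc L M c \<and> \<psi> \<in> Fml L UNIV UNIV \<and> \<psi>' \<in> Fml L UNIV UNIV"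
  obtains \<eta> where "\<eta> \<in> EL_Sc L M c" "\<And>P. P \<in> Sc L M c \<Longrightarrow> \<eta> P \<in> Sc L M c"
    "\<And>P \<psi> \<psi>'. (P, \<psi>, \<psi>') \<in> D \<Longrightarrow> \<psi> \<in> \<eta> P \<longleftrightarrow> \<psi>' \<in> \<eta> P"
proof -
  let ?X = "Sc_topology L M c"
  note top = topspace_Sc_topology[of L M c]
  define R :: "('f, 'r, 'i, 'm) fm set \<times> ('f, 'r, 'i, 'm) fm \<times> ('f, 'r, 'i, 'm) fm \<Rightarrow> ('m \<Rightarrow> 'm) \<Rightarrow> bool"
    where "R = (\<lambda>(P, \<psi>, \<psi>') \<sigma>. \<psi> \<in> act_type \<sigma> P \<longleftrightarrow> \<psi>' \<in> act_type \<sigma> P)"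
  obtain U where U: "ultra U" and evAut: "eventually (\<lambda>\<sigma>. \<sigma> \<in> Aut L M) U"
    and ev: "\<And>d. d \<in> D \<Longrightarrow> eventually (R d) U"
  proof (rule ultrafilter_of_finite_intersections[of D "Aut L M" R])
    fix F assume "finite F" "F \<subseteq> D"
    then show "\<exists>\<sigma>\<in>Aut L M. \<forall>d\<in>F. R d \<sigma>" using fin[of F] by (simp add: R_def case_prod_beta')
  qed (rule that)
  have nonbot: "U \<noteq> bot" using U by (simp add: ultra_def)
  \<comment> \<open>The pointwise limit along \<open>U\<close>; \<open>restrict\<close> makes it a
    point of the product space.\<close>
  define \<eta> where "\<eta> = restrict (\<lambda>P. {\<psi> \<in> Fml L UNIV UNIV. eventually (\<lambda>\<sigma>. \<psi> \<in> act_type \<sigma> P) U}) (Sc L M c)"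
  have mem: "\<psi> \<in> \<eta> P \<longleftrightarrow> eventually (\<lambda>\<sigma>. \<psi> \<in> act_type \<sigma> P) U"
    if "P \<in> Sc L M c" "\<psi> \<in> Fml L UNIV UNIV" for P \<psi>
    using that by (simp add: \<eta>_def)
  have sub: "\<psi> \<in> Fml L UNIV UNIV" if "P \<in> Sc L M c" "\<psi> \<in> \<eta> P" for P \<psi>
    using that by (simp add: \<eta>_def)
  have evSc: "eventually (\<lambda>\<sigma>. act_type \<sigma> P \<in> Sc L M c) U" if "P \<in> Sc L M c" for P
    using evAut by (rule eventually_mono) (use that act_type_Sc in blast)
  have \<eta>Sc: "\<eta> P \<in> Sc L M c" if P: "P \<in> Sc L M c" for P
    unfolding Sc_def ctypes_def
  proof (intro CollectI conjI allI impI ballI subsetI)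
    fix F assume F: "finite F \<and> F \<subseteq> \<eta> P"
    \<comment> \<open>A finite part of the limit is contained in a single moved type, which is
      finitely satisfiable.\<close>
    then have "eventually (\<lambda>\<sigma>. \<forall>\<psi>\<in>F. \<psi> \<in> act_type \<sigma> P) U"
      using mem[OF P] sub[OF P] by (auto intro!: eventually_ball_finite)
    then have "eventually (\<lambda>\<sigma>. F \<subseteq> act_type \<sigma> P \<and> act_type \<sigma> P \<in> Sc L M c) U"
      using evSc[OF P] by eventually_elim auto
    then obtain \<sigma> where "F \<subseteq> act_type \<sigma> P" "act_type \<sigma> P \<in> Sc L M c"
      using eventually_happens[of _ U] nonbot by blast
    then show "\<exists>v. \<forall>\<phi>\<in>F. sat M v \<phi>" using ctypes_finitely_sat[OF Sc_ctypes] F by blast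
  next
    fix \<phi> :: "('f, 'r, 'i, 'm) fm" assume \<phi>: "\<phi> \<in> Fml L UNIV UNIV"
    show "\<phi> \<in> \<eta> P \<or> Neg \<phi> \<in> \<eta> P"
    proof (cases "\<phi> \<in> \<eta> P")
      case False
      then have "eventually (\<lambda>\<sigma>. \<phi> \<notin> act_type \<sigma> P) U"
        using mem[OF P \<phi>] ultra_eventually_not[OF U] by auto
      with evSc[OF P] have "eventually (\<lambda>\<sigma>. Neg \<phi> \<in> act_type \<sigma> P) U"
        by eventually_elim (use ctypes_Neg[OF Sc_ctypes \<phi>] in blast)
      then show ?thesis using mem[OF P, of "Neg \<phi>"] \<phi> by simp
    qed simp
  next
    fix \<phi> assume \<phi>: "\<phi> \<in> {\<phi> \<in> Fml L UNIV {}. sat M c \<phi>}"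
    have "eventually (\<lambda>\<sigma>. \<phi> \<in> act_type \<sigma> P) U"
      using evSc[OF P] by (rule eventually_mono) (use \<phi> in \<open>auto simp: Sc_def\<close>)
    moreover have "\<phi> \<in> Fml L UNIV UNIV" using \<phi> by (auto intro: Fml_mono)
    ultimately show "\<phi> \<in> \<eta> P" using mem[OF P] by blast
  qed (use sub[OF P] in blast)
  \<comment> \<open>A subbasic open set asks for one formula, and membership of a formula in
    \<open>\<eta> P\<close> was defined as eventual membership.\<close>
  have lim: "limitin ?X (\<lambda>\<sigma>. act_type \<sigma> P) (\<eta> P) U" if P: "P \<in> Sc L M c" for P
    unfolding Sc_topology_def
  proof (rule limitin_topology_generated_by)
    show "\<eta> P \<in> \<Union> ((\<lambda>\<phi>. {p \<in> Sc L M c. \<phi> \<in> p}) ` Fml L UNIV UNIV)"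
      using \<eta>Sc[OF P] top unfolding Sc_topology_def topology_generated_by_topspace by simp
    fix S assume S: "S \<in> (\<lambda>\<phi>. {p \<in> Sc L M c. \<phi> \<in> p}) ` Fml L UNIV UNIV" "\<eta> P \<in> S"
    then obtain \<phi> where \<phi>: "\<phi> \<in> Fml L UNIV UNIV" "S = {p \<in> Sc L M c. \<phi> \<in> p}" by blast
    with S have "eventually (\<lambda>\<sigma>. \<phi> \<in> act_type \<sigma> P) U" using mem[OF P] by blast
    with evSc[OF P] show "eventually (\<lambda>\<sigma>. act_type \<sigma> P \<in> S) U"
      by eventually_elim (simp add: \<phi>)
  qed
  have "limitin (product_topology (\<lambda>_. ?X) (topspace ?X)) (\<lambda>\<sigma>. restrict (act_type \<sigma>) (topspace ?X)) \<eta> U"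
    unfolding limitin_componentwise
  proof (intro conjI ballI)
    show "\<eta> \<in> extensional (topspace ?X)" by (simp add: \<eta>_def top)
    show "eventually (\<lambda>\<sigma>. restrict (act_type \<sigma>) (topspace ?X) \<in> topspace (product_topology (\<lambda>_. ?X) (topspace ?X))) U"
      using evAut by eventually_elim (auto simp: top act_type_Sc)
    show "limitin ?X (\<lambda>\<sigma>. restrict (act_type \<sigma>) (topspace ?X) P) (\<eta> P) U" if "P \<in> topspace ?X" for P
      using lim[of P] that by (simp add: top)
  qed
  \<comment> \<open>A proper filter concentrating on automorphisms meets every neighborhood of its
    limit.\<close>
  then have "\<eta> \<in> EL_Sc L M c"
    unfolding EL_Sc_def Ellis_def in_closure_of limitin_def
  proof (elim conjE, intro conjI allI impI)
    fix T
    assume "\<forall>V. openin (product_topology (\<lambda>_. ?X) (topspace ?X)) V \<and> \<eta> \<in> V \<longrightarrow>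
        eventually (\<lambda>\<sigma>. restrict (act_type \<sigma>) (topspace ?X) \<in> V) U"
      and "\<eta> \<in> T \<and> openin (product_topology (\<lambda>_. ?X) (topspace ?X)) T"
    then have "eventually (\<lambda>\<sigma>. restrict (act_type \<sigma>) (topspace ?X) \<in> T) U" by blast
    then have "eventually (\<lambda>\<sigma>. restrict (act_type \<sigma>) (topspace ?X) \<in> T \<and> \<sigma> \<in> Aut L M) U"
      using evAut by eventually_elim auto
    then obtain \<sigma> where "restrict (act_type \<sigma>) (topspace ?X) \<in> T" "\<sigma> \<in> Aut L M"
      using eventually_happens[of _ U] nonbot by blast
    then show "\<exists>y. y \<in> (\<lambda>\<sigma>. restrict (act_type \<sigma>) (topspace ?X)) ` Aut L M \<and> y \<in> T" by blast
  qed
  moreover have "\<psi> \<in> \<eta> P \<longleftrightarrow> \<psi>' \<in> \<eta> P" if d: "(P, \<psi>, \<psi>') \<in> D" for P \<psi> \<psi>'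
  proof -
    have "eventually (R (P, \<psi>, \<psi>')) U" using ev d by blast
    then have "eventually (\<lambda>\<sigma>. \<psi> \<in> act_type \<sigma> P) U \<longleftrightarrow> eventually (\<lambda>\<sigma>. \<psi>' \<in> act_type \<sigma> P) U"
      by (intro eventually_subst) (auto elim: eventually_mono simp: R_def)
    then show ?thesis using mem D[OF d] by blast
  qed
  ultimately show thesis using that \<eta>Sc by blast
qed

section \<open>Ramsey property and invariant types\<close>

lemma monster_conj_aut:
  assumes "monster_model L T \<kappa> M" "same_type L M a a'"
  obtains \<sigma> where "\<sigma> \<in> Aut L M" "map \<sigma> a = a'"
  using assms same_type_conj_aut[of L \<kappa> M a a'] unfolding monster_model_def by blast

lemma map_inv_aut:
  assumes "\<sigma> \<in> Aut L M"
  shows "map \<sigma> (map (inv \<sigma>) a) = a" "map (inv \<sigma>) (map \<sigma> a) = a"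
  using assms by (auto simp: Aut_def bij_def surj_f_inv_f inv_f_f intro!: map_idI)

text \<open>\<open>P\<close> enters an externally definable coloring only through the variables of \<open>\<phi>\<close>, listed in \<open>ys\<close>.\<close>

lemma type_in_finitely_many_variables:
  assumes P: "P \<in> Sc L M c" and \<phi>: "\<phi> \<in> Fml2 L k UNIV" and ys: "{y. Inr y \<in> fvars \<phi>} \<subseteq> set ys"
  obtains \<phi>' p where "\<phi>' \<in> Fml2 L k {..<length ys}" "p \<in> ctypes L M {..<length ys} UNIV"
    "\<And>a. inst a \<phi>' \<in> p \<longleftrightarrow> inst a \<phi> \<in> P"
proof -
  define ix where "ix y = (SOME i. i < length ys \<and> ys ! i = y)" for y
  have ix: "ix y < length ys" "ys ! ix y = y" if "Inr y \<in> fvars \<phi>" for y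
    unfolding ix_def using SOME_nth[of y ys] ys that by auto
  define \<phi>' where "\<phi>' = map_fm (map_sum id ix) id \<phi>"
  \<comment> \<open>The restriction of \<open>P\<close> to the listed variables, renumbered so that
    \<open>i\<close> stands for \<open>ys ! i\<close>.\<close>
  define p where "p = {\<psi> \<in> Fml L {..<length ys} UNIV. map_fm (nth ys) id \<psi> \<in> P}"
  note P' = Sc_ctypes[OF P]
  have nthF: "map_fm (nth ys) id \<psi> \<in> Fml L UNIV UNIV" if "\<psi> \<in> Fml L {..<length ys} UNIV" for \<psi>
    using that by (rule map_fm_in_Fml) auto
  have \<phi>': "\<phi>' \<in> Fml2 L k {..<length ys}"
    using \<phi> ix(1) by (fastforce simp: Fml2_def Fml_def \<phi>'_def fm.set_map)
  moreover have "p \<in> ctypes L M {..<length ys} UNIV"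
    unfolding ctypes_def
  proof (intro CollectI conjI allI impI ballI)
    fix F assume F: "finite F \<and> F \<subseteq> p"
    then have "finite (map_fm (nth ys) id ` F)" "map_fm (nth ys) id ` F \<subseteq> P" by (auto simp: p_def)
    then obtain v where "\<forall>\<phi>\<in>map_fm (nth ys) id ` F. sat M v \<phi>"
      using ctypes_finitely_sat[OF P'] by blast
    then have "\<forall>\<psi>\<in>F. sat M (v \<circ> nth ys) \<psi>" by (simp add: sat_map_fvars)
    then show "\<exists>v. \<forall>\<psi>\<in>F. sat M v \<psi>" by blast
  next
    fix \<psi> assume \<psi>: "\<psi> \<in> Fml L {..<length ys} (UNIV :: 'd set)"
    have "map_fm (nth ys) id (Neg \<psi>) = Neg (map_fm (nth ys) id \<psi>)" by (simp add: id_def)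
    then show "\<psi> \<in> p \<or> Neg \<psi> \<in> p"
      using \<psi> ctypes_Neg[OF P' nthF[OF \<psi>]] by (auto simp: p_def)
  qed (auto simp: p_def)
  moreover have "inst a \<phi>' \<in> p \<longleftrightarrow> inst a \<phi> \<in> P" for a
  proof -
    have "inst a \<phi>' = map_fm ix id (inst a \<phi>)" by (simp add: \<phi>'_def inst_map_fvars)
    then have "map_fm (nth ys) id (inst a \<phi>') = map_fm (nth ys \<circ> ix) id (inst a \<phi>)"
      by (simp add: fm.map_comp)
    \<comment> \<open>The two renamings cancel on the variables that occur.\<close>
    also have "\<dots> = map_fm id id (inst a \<phi>)"
      by (rule fm.map_cong0) (auto simp: fvars_inst ix)
    finally have "map_fm (nth ys) id (inst a \<phi>') = inst a \<phi>" by (simp add: fm.map_id)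
    then show ?thesis using inst_in_Fml[OF \<phi>'] by (simp add: p_def)
  qed
  ultimately show thesis by (rule that)
qed

text \<open>All constraints are packed into one coloring, and the Ramsey property is applied to a
  tuple \<open>b\<close> that contains every tuple in \<open>D\<close>. The automorphism taking the
  monochromatic copy \<open>b'\<close> back to \<open>b\<close> satisfies them.\<close>

lemma type_EDEERP_finite:
  fixes M :: "('f, 'r, 'm) struct" and c :: "'i \<Rightarrow> 'm"
    and D :: "(('f, 'r, 'i, 'm) fm set \<times> ('f, 'r, nat + 'i, 'm) fm \<times> 'm list \<times> 'm list) set"
  assumes mon: "monster_model L T \<kappa> M" and q: "q \<in> ctypes L M {..<k} {}"
    and ramsey: "type_EDEERP L M k q" and fin: "finite D"
    and D: "\<And>P \<phi> a a'. (P, \<phi>, a, a') \<in> D \<Longrightarrow> P \<in> Sc L M c \<and> \<phi> \<in> Fml2 L k UNIV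
      \<and> realizes M k a q \<and> realizes M k a' q"
  obtains \<sigma> where "\<sigma> \<in> Aut L M" "\<And>P \<phi> a a'. (P, \<phi>, a, a') \<in> D \<Longrightarrow>
    inst a \<phi> \<in> act_type \<sigma> P \<longleftrightarrow> inst a' \<phi> \<in> act_type \<sigma> P"
proof -
  obtain a0 where a0: "realizes M k a0 q"
    and mono: "\<And>b n col. set a0 \<subseteq> set b \<Longrightarrow> coloring L M a0 n col \<Longrightarrow> externally_definable L M a0 n col \<Longrightarrow>
      \<exists>b'\<in>copies L M UNIV b. monochromatic col (copies L M (set b') a0)"
    using ramsey unfolding type_EDEERP_def by blast
  have len: "length a0 = k" using a0 by (simp add: realizes_def)
  obtain ds where ds: "set ds = D" using finite_list[OF fin] by blast
  define n where "n = length ds"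
  define P where "P i = fst (ds ! i)" for i
  define \<phi> where "\<phi> i = fst (snd (ds ! i))" for i
  \<comment> \<open>\<open>a0\<close> is included because the Ramsey property applies only to tuples
    containing it.\<close>
  define A where "A = (\<Union>(P, \<phi>, a, a')\<in>D. set a \<union> set a') \<union> set a0"
  have "finite A" using fin by (auto simp: A_def)
  then obtain b where b: "set b = A" using finite_list by blast
  have Pi: "P i \<in> Sc L M c" and \<phi>i: "\<phi> i \<in> Fml2 L k UNIV" if "i < n" for i
  proof -
    have "ds ! i \<in> D" using that ds by (auto simp: n_def)
    then show "P i \<in> Sc L M c" "\<phi> i \<in> Fml2 L k UNIV"
      using D[of "P i" "\<phi> i" "fst (snd (snd (ds ! i)))" "snd (snd (snd (ds ! i)))"]
      by (auto simp: P_def \<phi>_def)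
  qed
  have "finite (Inr -` fvars (\<phi> i))" for i by (rule finite_vimageI) auto
  then have "finite (\<Union>i<n. {y. Inr y \<in> fvars (\<phi> i)})" by (simp add: vimage_def)
  \<comment> \<open>One list serves all \<open>i\<close>, since the types defining an external
    coloring share their number of variables.\<close>
  from finite_list[OF this] obtain ys where ys: "set ys = (\<Union>i<n. {y. Inr y \<in> fvars (\<phi> i)})" ..
  \<comment> \<open>Coordinate \<open>i\<close> records membership for the \<open>i\<close>-th
    formula and type; the restriction to \<open>{..<n}\<close> gives the extensional functions that
    \<open>coloring\<close> asks for.\<close>
  define col where "col a = (\<lambda>i\<in>{..<n}. if inst a (\<phi> i) \<in> P i then 1 else 0 :: nat)" for a
  have "coloring L M a0 n col" unfolding coloring_def by (rule funcsetI) (simp add: col_def)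
  moreover have "externally_definable L M a0 n col"
  proof -
    have "\<exists>\<phi>' p. \<phi>' \<in> Fml2 L k {..<length ys} \<and> p \<in> ctypes L M {..<length ys} UNIV
        \<and> (\<forall>a. inst a \<phi>' \<in> p \<longleftrightarrow> inst a (\<phi> i) \<in> P i)" if "i < n" for i
    proof -
      have "{y. Inr y \<in> fvars (\<phi> i)} \<subseteq> set ys" using ys that by blast
      then show ?thesis
        using type_in_finitely_many_variables[OF Pi[OF that] \<phi>i[OF that]] by metis
    qed
    then obtain \<phi>' p where "\<forall>i<n. \<phi>' i \<in> Fml2 L k {..<length ys} \<and> p i \<in> ctypes L M {..<length ys} UNIV
        \<and> (\<forall>a. inst a (\<phi>' i) \<in> p i \<longleftrightarrow> inst a (\<phi> i) \<in> P i)" by metis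
    then have "\<forall>i<n. \<phi>' i \<in> Fml2 L (length a0) {..<length ys} \<and> p i \<in> ctypes L M {..<length ys} UNIV
        \<and> (\<forall>a'\<in>copies L M UNIV a0. col a' i = 1 \<longleftrightarrow> inst a' (\<phi>' i) \<in> p i)"
      by (simp add: len col_def)
    then show ?thesis unfolding externally_definable_def by blast
  qed
  moreover have "set a0 \<subseteq> set b" by (simp add: b A_def)
  ultimately have "\<exists>b'\<in>copies L M UNIV b. monochromatic col (copies L M (set b') a0)"
    by (intro mono)
  then obtain b' where b': "same_type L M b' b" "monochromatic col (copies L M (set b') a0)"
    unfolding copies_def[of _ _ UNIV] by blast
  obtain \<sigma> where \<sigma>: "\<sigma> \<in> Aut L M" "map \<sigma> b' = b"
    using monster_conj_aut[OF mon b'(1)] .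
  have inv_b: "map (inv \<sigma>) b = b'" using map_inv_aut(2)[OF \<sigma>(1), of b'] \<sigma>(2) by simp
  have copy: "map (inv \<sigma>) a \<in> copies L M (set b') a0" if "realizes M k a q" "set a \<subseteq> A" for a
  proof -
    have "set (map (inv \<sigma>) a) \<subseteq> set b'" using that(2) unfolding inv_b[symmetric] b[symmetric] by auto
    moreover have "same_type L M (map (inv \<sigma>) a) a"
      using same_type_aut[OF \<sigma>(1), of "map (inv \<sigma>) a"] unfolding map_inv_aut(1)[OF \<sigma>(1)] .
    moreover have "same_type L M a a0" using realizes_iff_same_type[OF q a0] that(1) by blast
    ultimately show ?thesis by (auto simp: copies_def intro: same_type_trans)
  qed
  \<comment> \<open>The moved types see at \<open>a\<close> the color of its preimage, and by
    \<open>copy\<close> the preimages of all relevant tuples lie in the monochromatic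
    \<open>b'\<close>.\<close>
  have act: "inst a (\<phi> i) \<in> act_type \<sigma> (P i) \<longleftrightarrow> col (map (inv \<sigma>) a) i = 1"
    if "i < n" "length a = k" for a i
  proof -
    have "\<phi> i \<in> Fml2 L (length (map (inv \<sigma>) a)) UNIV" using \<phi>i that by simp
    from inst_mem_act_type[OF \<sigma>(1) this, of "P i"] show ?thesis
      using that(1) by (simp only: map_inv_aut(1)[OF \<sigma>(1)]) (simp add: col_def)
  qed
  have "inst a \<psi> \<in> act_type \<sigma> Q \<longleftrightarrow> inst a' \<psi> \<in> act_type \<sigma> Q" if d: "(Q, \<psi>, a, a') \<in> D" for Q \<psi> a a'
  proof -
    obtain i where i: "i < n" "ds ! i = (Q, \<psi>, a, a')"
      using d unfolding ds[symmetric] in_set_conv_nth n_def by blast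
    have r: "realizes M k a q" "realizes M k a' q" using D[OF d] by auto
    have "set a \<subseteq> A" "set a' \<subseteq> A" using d unfolding A_def by fastforce+
    then have "col (map (inv \<sigma>) a) = col (map (inv \<sigma>) a')"
      using b'(2) copy r unfolding monochromatic_def by (metis imageI singletonD)
    moreover have "length a = k" "length a' = k" using r by (auto simp: realizes_def)
    moreover have "P i = Q" "\<phi> i = \<psi>" using i(2) by (auto simp: P_def \<phi>_def)
    ultimately show ?thesis using act[OF i(1)] by metis
  qed
  with \<sigma>(1) show thesis by (rule that)
qed

text \<open>The conditions defining \<open>Inv_qc\<close>, taken for all types at once, are a family
  for \<open>EL_Sc_limit\<close>; finite subfamilies are met by
  \<open>type_EDEERP_finite\<close>.\<close>

lemma type_EDEERP_imp_Inv_qc: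
  fixes M :: "('f, 'r, 'm) struct" and c :: "'i \<Rightarrow> 'm"
  assumes mon: "monster_model L T \<kappa> M" and q: "q \<in> ctypes L M {..<k} {}"
    and ramsey: "type_EDEERP L M k q"
  shows "\<exists>\<eta>\<in>EL_Sc L M c. \<eta> ` Sc L M c \<subseteq> Inv_qc L M k q c"
proof -
  define E :: "(('f, 'r, 'i, 'm) fm set \<times> ('f, 'r, nat + 'i, 'm) fm \<times> 'm list \<times> 'm list) set"
    where "E = {(P, \<phi>, a, a'). P \<in> Sc L M c \<and> \<phi> \<in> Fml2 L k UNIV \<and> realizes M k a q \<and> realizes M k a' q}"
  let ?f = "\<lambda>(P, \<phi>, a, a'). (P, inst a \<phi>, inst a' \<phi>)"
  obtain \<eta> where \<eta>: "\<eta> \<in> EL_Sc L M c" "\<And>P. P \<in> Sc L M c \<Longrightarrow> \<eta> P \<in> Sc L M c"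
    "\<And>P \<psi> \<psi>'. (P, \<psi>, \<psi>') \<in> ?f ` E \<Longrightarrow> \<psi> \<in> \<eta> P \<longleftrightarrow> \<psi>' \<in> \<eta> P"
  proof (rule EL_Sc_limit[where D = "?f ` E" and L = L and M = M and c = c])
    fix F assume "finite F" "F \<subseteq> ?f ` E"
    then obtain D where D: "finite D" "D \<subseteq> E" "F = ?f ` D" by (meson finite_subset_image)
    obtain \<sigma> where "\<sigma> \<in> Aut L M" "\<And>P \<phi> a a'. (P, \<phi>, a, a') \<in> D \<Longrightarrow>
        inst a \<phi> \<in> act_type \<sigma> P \<longleftrightarrow> inst a' \<phi> \<in> act_type \<sigma> P"
      using type_EDEERP_finite[OF mon q ramsey D(1), of c] D(2) unfolding E_def by blast
    then show "\<exists>\<sigma>\<in>Aut L M. \<forall>(P, \<psi>, \<psi>')\<in>F. \<psi> \<in> act_type \<sigma> P \<longleftrightarrow> \<psi>' \<in> act_type \<sigma> P"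
      by (intro bexI[of _ \<sigma>]) (auto simp: D(3))
  next
    fix P \<psi> \<psi>' assume "(P, \<psi>, \<psi>') \<in> ?f ` E"
    then show "P \<in> Sc L M c \<and> \<psi> \<in> Fml L UNIV UNIV \<and> \<psi>' \<in> Fml L UNIV UNIV"
      by (auto simp: E_def intro: inst_in_Fml)
  qed (rule that)
  have "\<eta> P \<in> Inv_qc L M k q c" if P: "P \<in> Sc L M c" for P
    unfolding Inv_qc_def
  proof (intro CollectI conjI ballI allI impI)
    fix \<phi> :: "('f, 'r, nat + 'i, 'm) fm" and a a'
    assume "\<phi> \<in> Fml2 L k UNIV" "realizes M k a q \<and> realizes M k a' q"
    then have "(P, \<phi>, a, a') \<in> E" using P by (simp add: E_def)
    then have "(P, inst a \<phi>, inst a' \<phi>) \<in> ?f ` E" by force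
    then show "inst a \<phi> \<in> \<eta> P \<longleftrightarrow> inst a' \<phi> \<in> \<eta> P" by (rule \<eta>(3))
  qed (rule \<eta>(2)[OF P])
  then show ?thesis using \<eta>(1) by blast
qed

text \<open>Only finitely many copies of \<open>a\<close> lie in \<open>b\<close>, so an
  automorphism can imitate \<open>\<eta>\<close> on all of them. As \<open>\<eta>\<close> takes
  values that do not distinguish realizations of \<open>q\<close>, the preimage of \<open>b\<close>
  is monochromatic.\<close>

lemma Inv_qc_imp_type_EDEERP:
  fixes M :: "('f, 'r, 'm) struct" and c :: "'i \<Rightarrow> 'm"
  assumes mon: "monster_model L T \<kappa> M" and "surj c" and q: "q \<in> ctypes L M {..<k} {}"
    and \<eta>: "\<eta> \<in> EL_Sc L M c" "\<eta> ` Sc L M c \<subseteq> Inv_qc L M k q c"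
  shows "type_EDEERP L M k q"
proof -
  have sat: "saturated L \<kappa> M" and hom: "strongly_homogeneous L \<kappa> M" and \<kappa>: "Card_order \<kappa>" "natLeq <o \<kappa>"
    using mon by (auto simp: monster_model_def)
  have "|{} :: 'm set| <o \<kappa>"
    using \<kappa>(2) finite_iff_ordLess_natLeq[of "{} :: 'm set"] by (meson finite.emptyI ordLess_transitive)
  then obtain a where a: "realizes M k a q" using sat q unfolding saturated_def by blast
  have len: "length a = k" using a by (simp add: realizes_def)
  have "\<exists>b'\<in>copies L M UNIV b. monochromatic col (copies L M (set b') a)"
    if ab: "set a \<subseteq> set b" and col: "coloring L M a n col" and ed: "externally_definable L M a n col" for b n col
  proof -
    obtain m \<phi> p where mp: "\<And>i. i < n \<Longrightarrow> \<phi> i \<in> Fml2 L k {..<m :: nat}"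
      "\<And>i. i < n \<Longrightarrow> p i \<in> ctypes L M {..<m} UNIV"
      "\<And>i a'. i < n \<Longrightarrow> a' \<in> copies L M UNIV a \<Longrightarrow> col a' i = 1 \<longleftrightarrow> inst a' (\<phi> i) \<in> p i"
      using ed unfolding externally_definable_def len by blast
    \<comment> \<open>Each \<open>p i\<close> is lifted separately and gets its own renaming of
      variables, which \<open>\<phi>'\<close> then applies to \<open>\<phi> i\<close>.\<close>
    have "\<exists>j P. P \<in> Sc L M c \<and> (\<forall>\<psi>\<in>Fml L {..<m} UNIV. map_fm j id \<psi> \<in> P \<longleftrightarrow> \<psi> \<in> p i)" if "i < n" for i
      using ctypes_lift_Sc[OF sat hom \<kappa> \<open>surj c\<close> mp(2)[OF that]] by metis
    then obtain j P where P: "\<And>i. i < n \<Longrightarrow> P i \<in> Sc L M c"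
      "\<And>i \<psi>. i < n \<Longrightarrow> \<psi> \<in> Fml L {..<m} UNIV \<Longrightarrow> map_fm (j i) id \<psi> \<in> P i \<longleftrightarrow> \<psi> \<in> p i" by metis
    define \<phi>' where "\<phi>' i = map_fm (map_sum id (j i)) id (\<phi> i)" for i
    have \<phi>': "\<phi>' i \<in> Fml2 L k UNIV" if "i < n" for i
      using mp(1)[OF that] by (fastforce simp: Fml2_def Fml_def \<phi>'_def fm.set_map)
    have col_iff: "col a' i = 1 \<longleftrightarrow> inst a' (\<phi>' i) \<in> P i" if "i < n" "a' \<in> copies L M UNIV a" for i a'
      using mp(3)[OF that] P(2)[OF that(1) inst_in_Fml[OF mp(1)[OF that(1)]]]
      by (simp add: \<phi>'_def inst_map_fvars)
    have "copies L M (set b) a \<subseteq> {a'. set a' \<subseteq> set b \<and> length a' = k}"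
      by (auto simp: copies_def same_type_def len)
    then have fin: "finite (copies L M (set b) a)"
      by (rule finite_subset) (simp add: finite_lists_length_eq)
    \<comment> \<open>All memberships that can arise when a copy of \<open>a\<close> inside
      \<open>b'\<close> is moved into \<open>b\<close>.\<close>
    define D where "D = (\<lambda>(i, a'). (P i, inst a' (\<phi>' i))) ` ({..<n} \<times> copies L M (set b) a)"
    obtain \<sigma> where \<sigma>: "\<sigma> \<in> Aut L M" "\<And>Q \<psi>. (Q, \<psi>) \<in> D \<Longrightarrow> \<psi> \<in> act_type \<sigma> Q \<longleftrightarrow> \<psi> \<in> \<eta> Q"
    proof (rule EL_Sc_approx[OF \<eta>(1), of D])
      show "finite D" using fin by (simp add: D_def)
      show "Q \<in> Sc L M c \<and> \<psi> \<in> Fml L UNIV UNIV" if "(Q, \<psi>) \<in> D" for Q \<psi>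
        using that P(1) inst_in_Fml[OF \<phi>'] by (auto simp: D_def)
    qed (rule that)
    define b' where "b' = map (inv \<sigma>) b"
    have \<sigma>b': "map \<sigma> b' = b" unfolding b'_def by (rule map_inv_aut(1)[OF \<sigma>(1)])
    have "same_type L M b' b" using same_type_aut[OF \<sigma>(1), of b'] \<sigma>b' by simp
    then have b'_copy: "b' \<in> copies L M UNIV b" by (simp add: copies_def)
    have same: "a' \<in> copies L M UNIV a" "map \<sigma> a' \<in> copies L M (set b) a" if "a' \<in> copies L M (set b') a" for a'
    proof -
      show "a' \<in> copies L M UNIV a" using that by (simp add: copies_def)
      have "same_type L M (map \<sigma> a') a"
        using that same_type_aut[OF \<sigma>(1), of a'] by (auto simp: copies_def intro: same_type_trans same_type_sym)
      moreover have "set (map \<sigma> a') \<subseteq> set b" using that unfolding \<sigma>b'[symmetric] by (auto simp: copies_def)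
      ultimately show "map \<sigma> a' \<in> copies L M (set b) a" by (simp add: copies_def)
    qed
    \<comment> \<open>\<open>\<sigma>\<close> takes \<open>a'\<close> into \<open>b\<close>, where
      the moved type agrees with \<open>\<eta> (P i)\<close>; invariance then replaces the tuple by
      \<open>a\<close>, so the result does not depend on \<open>a'\<close>.\<close>
    have col_eq: "col a' i = 1 \<longleftrightarrow> inst a (\<phi>' i) \<in> \<eta> (P i)" if i: "i < n" and a': "a' \<in> copies L M (set b') a" for a' i
    proof -
      note c = same[OF a']
      have la: "length a' = k" using c(1) by (simp add: copies_def same_type_def len)
      have "col a' i = 1 \<longleftrightarrow> inst (map \<sigma> a') (\<phi>' i) \<in> act_type \<sigma> (P i)"
        using col_iff[OF i c(1)] inst_mem_act_type[OF \<sigma>(1), of "\<phi>' i" a' UNIV] \<phi>'[OF i] la by simp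
      also have "\<dots> \<longleftrightarrow> inst (map \<sigma> a') (\<phi>' i) \<in> \<eta> (P i)"
        by (rule \<sigma>(2)) (use i c(2) in \<open>force simp: D_def\<close>)
      also have "\<dots> \<longleftrightarrow> inst a (\<phi>' i) \<in> \<eta> (P i)"
      proof -
        have "realizes M k (map \<sigma> a') q"
          using c(2) realizes_iff_same_type[OF q a] by (simp add: copies_def)
        then show ?thesis using a \<eta>(2) P(1)[OF i] \<phi>'[OF i] by (auto simp: Inv_qc_def)
      qed
      finally show ?thesis .
    qed
    \<comment> \<open>\<open>monochromatic\<close> includes that the set is nonempty; since
      \<open>b\<close> contains \<open>a\<close>, its preimage contains a copy of
      \<open>a\<close>.\<close>
    have "map (inv \<sigma>) a \<in> copies L M (set b') a"
      using same_type_aut[OF \<sigma>(1), of "map (inv \<sigma>) a"] ab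
      by (auto simp: copies_def b'_def simp del: map_map simp: map_inv_aut(1)[OF \<sigma>(1)])
    moreover have "col a1 = col a2" if "a1 \<in> copies L M (set b') a" "a2 \<in> copies L M (set b') a" for a1 a2
    proof (rule PiE_ext)
      show c12: "col a1 \<in> {..<n} \<rightarrow>\<^sub>E {0, 1}" "col a2 \<in> {..<n} \<rightarrow>\<^sub>E {0, 1}"
        using funcset_mem[OF col[unfolded coloring_def]] same(1) that by blast+
      fix i assume "i \<in> {..<n}"
      then have "col a1 i = 1 \<longleftrightarrow> col a2 i = 1" "col a1 i \<in> {0, 1}" "col a2 i \<in> {0, 1}"
        using col_eq that c12 by blast+
      then show "col a1 i = col a2 i" by auto
    qed
    ultimately have "col ` copies L M (set b') a = {col (map (inv \<sigma>) a)}" by blast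
    then show ?thesis using b'_copy unfolding monochromatic_def by blast
  qed
  then show ?thesis unfolding type_EDEERP_def using a by blast
qed

section \<open>From single types to the theory\<close>

lemma Inv_c_subset_Inv_qc:
  fixes M :: "('f, 'r, 'm) struct" and c :: "'i \<Rightarrow> 'm"
  assumes mon: "monster_model L T \<kappa> M" and q: "q \<in> ctypes L M {..<k} {}"
  shows "Inv_c L M c \<subseteq> Inv_qc L M k q c"
proof
  fix p assume p: "p \<in> Inv_c L M c"
  show "p \<in> Inv_qc L M k q c"
    unfolding Inv_qc_def
  proof (intro CollectI conjI ballI allI impI)
    show "p \<in> Sc L M c" using p by (simp add: Inv_c_def)
    fix \<phi> :: "('f, 'r, nat + 'i, 'm) fm" and a a'
    assume \<phi>: "\<phi> \<in> Fml2 L k UNIV" and a: "realizes M k a q \<and> realizes M k a' q"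
    \<comment> \<open>Realizations of \<open>q\<close> are conjugate, and an automorphism fixing
      \<open>p\<close> carries one instance of \<open>\<phi>\<close> to the other.\<close>
    then have "same_type L M a a'" using realizes_iff_same_type[OF q] by blast
    then obtain \<sigma> where \<sigma>: "\<sigma> \<in> Aut L M" "map \<sigma> a = a'" using monster_conj_aut[OF mon] by blast
    have "inst (map \<sigma> a) \<phi> \<in> act_type \<sigma> p \<longleftrightarrow> inst a \<phi> \<in> p"
      by (rule inst_mem_act_type[OF \<sigma>(1)]) (use \<phi> a in \<open>auto simp: realizes_def\<close>)
    moreover have "act_type \<sigma> p = p" using p \<sigma>(1) by (simp add: Inv_c_def)
    ultimately show "inst a \<phi> \<in> p \<longleftrightarrow> inst a' \<phi> \<in> p" using \<sigma>(2) by simp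
  qed
qed

text \<open>
  Finitely many formulas have their parameters in one finite tuple, so the Ramsey property of the
  type of that tuple handles them simultaneously.
\<close>

lemma theory_EDEERP_imp_Inv_c:
  fixes M :: "('f, 'r, 'm) struct" and c :: "'i \<Rightarrow> 'm"
  assumes mon: "monster_model L T \<kappa> M" and ramsey: "theory_EDEERP L M"
  shows "\<exists>\<eta>\<in>EL_Sc L M c. \<eta> ` Sc L M c \<subseteq> Inv_c L M c"
proof -
  \<comment> \<open>Each triple stands for one condition of invariance, between a formula and its
    image under an automorphism.\<close>
  define E :: "(('f, 'r, 'i, 'm) fm set \<times> ('f, 'r, 'i, 'm) fm \<times> ('m \<Rightarrow> 'm)) set"
    where "E = Sc L M c \<times> Fml L UNIV UNIV \<times> Aut L M"
  let ?f = "\<lambda>(P, \<psi>, \<tau>). (P, \<psi>, map_fm id \<tau> \<psi>)"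
  have tauF: "map_fm id \<tau> \<psi> \<in> Fml L UNIV UNIV" if "\<psi> \<in> Fml L UNIV UNIV" for \<psi> :: "('f, 'r, 'i, 'm) fm" and \<tau> :: "'m \<Rightarrow> 'm"
    using that by (rule map_fm_in_Fml) auto
  obtain \<eta> where \<eta>: "\<eta> \<in> EL_Sc L M c" "\<And>P. P \<in> Sc L M c \<Longrightarrow> \<eta> P \<in> Sc L M c"
    "\<And>P \<psi> \<psi>'. (P, \<psi>, \<psi>') \<in> ?f ` E \<Longrightarrow> \<psi> \<in> \<eta> P \<longleftrightarrow> \<psi>' \<in> \<eta> P"
  proof (rule EL_Sc_limit[where D = "?f ` E" and L = L and M = M and c = c])
    fix F assume "finite F" "F \<subseteq> ?f ` E"
    then obtain D where D: "finite D" "D \<subseteq> E" "F = ?f ` D" by (meson finite_subset_image)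
    have "finite (\<Union>(P, \<psi>, \<tau>)\<in>D. params \<psi>)" using D(1) by auto
    from finite_list[OF this] obtain a where a: "set a = (\<Union>(P, \<psi>, \<tau>)\<in>D. params \<psi>)" ..
    define k where "k = length a"
    define q where "q = {\<phi> \<in> Fml L {..<k} {}. sat M (nth a) \<phi>}"
    have q: "q \<in> ctypes L M {..<k} {}" "realizes M k a q"
      unfolding q_def using type_of_tuple[of a k] by (auto simp: k_def)
    then have "type_EDEERP L M k q" using ramsey by (simp add: theory_EDEERP_def)
    \<comment> \<open>\<open>\<psi>\<close> with its parameters read off from \<open>a\<close>. Its
      image under \<open>\<tau>\<close> is then the instance at \<open>map \<tau> a\<close>, another
      realization of \<open>q\<close>, so each condition compares two realizations.\<close>
    define \<theta> where "\<theta> \<psi> = (SOME \<phi>. \<phi> \<in> Fml2 L k UNIV \<and> inst a \<phi> = \<psi>)" for \<psi> :: "('f, 'r, 'i, 'm) fm"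
    have \<theta>: "\<theta> \<psi> \<in> Fml2 L k UNIV" "inst a (\<theta> \<psi>) = \<psi>" "inst (map \<tau> a) (\<theta> \<psi>) = map_fm id \<tau> \<psi>"
      "realizes M k (map \<tau> a) q" if d: "(P, \<psi>, \<tau>) \<in> D" for P \<psi> \<tau>
    proof -
      have "\<psi> \<in> Fml L UNIV UNIV" "params \<psi> \<subseteq> set a" "\<tau> \<in> Aut L M" using d D(2) a by (auto simp: E_def)
      then have "\<exists>\<phi>. \<phi> \<in> Fml2 L k UNIV \<and> inst a \<phi> = \<psi>" using abstract_params[of \<psi> L a] k_def by metis
      then have *: "\<theta> \<psi> \<in> Fml2 L k UNIV \<and> inst a (\<theta> \<psi>) = \<psi>" unfolding \<theta>_def by (rule someI_ex)
      then show "\<theta> \<psi> \<in> Fml2 L k UNIV" "inst a (\<theta> \<psi>) = \<psi>" by auto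
      have "map_fm id \<tau> (inst a (\<theta> \<psi>)) = inst (map \<tau> a) (\<theta> \<psi>)"
        by (rule inst_map_params[of _ _ UNIV]) (use * in \<open>auto simp: Fml2_def Fml_def k_def\<close>)
      then show "inst (map \<tau> a) (\<theta> \<psi>) = map_fm id \<tau> \<psi>" using * by simp
      show "realizes M k (map \<tau> a) q"
        using realizes_iff_same_type[OF q] same_type_sym[OF same_type_aut[OF \<open>\<tau> \<in> Aut L M\<close>]] by blast
    qed
    define D' where "D' = (\<lambda>(P, \<psi>, \<tau>). (P, \<theta> \<psi>, a, map \<tau> a)) ` D"
    obtain \<sigma> where \<sigma>: "\<sigma> \<in> Aut L M" "\<And>P \<phi> a a'. (P, \<phi>, a, a') \<in> D' \<Longrightarrow>
        inst a \<phi> \<in> act_type \<sigma> P \<longleftrightarrow> inst a' \<phi> \<in> act_type \<sigma> P"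
    proof (rule type_EDEERP_finite[OF mon q(1) \<open>type_EDEERP L M k q\<close>, of D' c])
      show "finite D'" using D(1) by (simp add: D'_def)
      show "P \<in> Sc L M c \<and> \<phi> \<in> Fml2 L k UNIV \<and> realizes M k a1 q \<and> realizes M k a2 q"
        if "(P, \<phi>, a1, a2) \<in> D'" for P \<phi> a1 a2
        using that \<theta>(1,4) q(2) D(2) by (fastforce simp: D'_def E_def)
    qed (rule that)
    have "\<psi> \<in> act_type \<sigma> P \<longleftrightarrow> map_fm id \<tau> \<psi> \<in> act_type \<sigma> P" if d: "(P, \<psi>, \<tau>) \<in> D" for P \<psi> \<tau>
    proof -
      have "(P, \<theta> \<psi>, a, map \<tau> a) \<in> D'" using d by (force simp: D'_def)
      from \<sigma>(2)[OF this] show ?thesis using \<theta>(2,3)[OF d] by simp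
    qed
    then show "\<exists>\<sigma>\<in>Aut L M. \<forall>(P, \<psi>, \<psi>')\<in>F. \<psi> \<in> act_type \<sigma> P \<longleftrightarrow> \<psi>' \<in> act_type \<sigma> P"
      using \<sigma>(1) by (intro bexI[of _ \<sigma>]) (auto simp: D(3))
  next
    fix P \<psi> \<psi>' assume "(P, \<psi>, \<psi>') \<in> ?f ` E"
    then show "P \<in> Sc L M c \<and> \<psi> \<in> Fml L UNIV UNIV \<and> \<psi>' \<in> Fml L UNIV UNIV"
      using tauF by (auto simp: E_def)
  qed (rule that)
  have "\<eta> P \<in> Inv_c L M c" if P: "P \<in> Sc L M c" for P
  proof -
    have "act_type \<tau> (\<eta> P) = \<eta> P" if \<tau>: "\<tau> \<in> Aut L M" for \<tau>
    proof -
      have move: "\<psi> \<in> \<eta> P \<longleftrightarrow> map_fm id \<tau> \<psi> \<in> \<eta> P" if "\<psi> \<in> Fml L UNIV UNIV" for \<psi>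
      proof (rule \<eta>(3))
        have "(P, \<psi>, \<tau>) \<in> E" using that P \<tau> by (simp add: E_def)
        then show "(P, \<psi>, map_fm id \<tau> \<psi>) \<in> ?f ` E" by force
      qed
      have inF: "\<psi> \<in> Fml L UNIV UNIV" if "\<psi> \<in> \<eta> P" for \<psi>
        using ctypes_Fml[OF Sc_ctypes[OF \<eta>(2)[OF P]] that] .
      show ?thesis
      proof
        show "act_type \<tau> (\<eta> P) \<subseteq> \<eta> P" using move inF by (auto simp: act_type_def)
        show "\<eta> P \<subseteq> act_type \<tau> (\<eta> P)"
        proof
          fix \<psi> assume \<psi>: "\<psi> \<in> \<eta> P"
          \<comment> \<open>For the reverse inclusion \<open>move\<close> is applied to the preimage
            of \<open>\<psi>\<close> under \<open>\<tau>\<close>.\<close>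
          let ?\<psi> = "map_fm id (inv \<tau>) \<psi>"
          have "\<tau> \<circ> inv \<tau> = id" using \<tau> by (auto simp: Aut_def bij_def surj_f_inv_f)
          then have id: "map_fm id \<tau> ?\<psi> = \<psi>" by (simp add: fm.map_comp fm.map_id)
          then have "?\<psi> \<in> \<eta> P" using move[OF tauF[OF inF[OF \<psi>]]] \<psi> by simp
          then show "\<psi> \<in> act_type \<tau> (\<eta> P)" unfolding act_type_def using id by (metis imageI)
        qed
      qed
    qed
    then show ?thesis using \<eta>(2)[OF P] by (simp add: Inv_c_def)
  qed
  then show ?thesis using \<eta>(1) by blast
qed

theorem theorem3p14:
  fixes L :: "('f, 'r) lang"
    and T :: "('f, 'r, nat, 'm) fm set"
    and \<kappa> :: "'k rel"
    and \<CC> :: "('f, 'r, 'm) struct"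
    and c :: "'i \<Rightarrow> 'm"
  assumes "complete_theory L T"
    and "monster_model L T \<kappa> \<CC>"
    and "surj c"
  shows "(\<forall>k. \<forall>q\<in>ctypes L \<CC> {..<k} {}.
            type_EDEERP L \<CC> k q \<longleftrightarrow> (\<exists>\<eta>\<in>EL_Sc L \<CC> c. \<eta> ` Sc L \<CC> c \<subseteq> Inv_qc L \<CC> k q c))
       \<and> (theory_EDEERP L \<CC> \<longleftrightarrow> (\<exists>\<eta>\<in>EL_Sc L \<CC> c. \<eta> ` Sc L \<CC> c \<subseteq> Inv_c L \<CC> c))"
proof (intro conjI allI ballI)
  fix k :: nat and q assume q: "q \<in> ctypes L \<CC> {..<k} {}"
  show "type_EDEERP L \<CC> k q \<longleftrightarrow> (\<exists>\<eta>\<in>EL_Sc L \<CC> c. \<eta> ` Sc L \<CC> c \<subseteq> Inv_qc L \<CC> k q c)"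
    using type_EDEERP_imp_Inv_qc[OF assms(2) q] Inv_qc_imp_type_EDEERP[OF assms(2,3) q] by blast
next
  show "theory_EDEERP L \<CC> \<longleftrightarrow> (\<exists>\<eta>\<in>EL_Sc L \<CC> c. \<eta> ` Sc L \<CC> c \<subseteq> Inv_c L \<CC> c)"
  proof
    assume "\<exists>\<eta>\<in>EL_Sc L \<CC> c. \<eta> ` Sc L \<CC> c \<subseteq> Inv_c L \<CC> c"
    then obtain \<eta> where \<eta>: "\<eta> \<in> EL_Sc L \<CC> c" "\<eta> ` Sc L \<CC> c \<subseteq> Inv_c L \<CC> c" by blast
    \<comment> \<open>Invariant types do not distinguish realizations of any \<open>q\<close>, so
      the same \<open>\<eta>\<close> serves every type.\<close>
    have "type_EDEERP L \<CC> k q" if q: "q \<in> ctypes L \<CC> {..<k} {}" for k q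
      using Inv_qc_imp_type_EDEERP[OF assms(2,3) q \<eta>(1)] \<eta>(2) Inv_c_subset_Inv_qc[OF assms(2) q] by blast
    then show "theory_EDEERP L \<CC>" by (simp add: theory_EDEERP_def)
  qed (rule theory_EDEERP_imp_Inv_c[OF assms(2)])
qed

end
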